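(* Let $n\ge2$, $1\le d_1<\dots<d_s\le n-1$, and let $Q^a(d_1,\dots,d_s)=\mathbb C[X^a_J]/I^a(d_1,\dots,d_s)$, where $I^a(d_1,\dots,d_s)$ is the ideal generated by the degenerate Plücker relations. Then the elements $X^a_T$, where $T$ runs over $ST^a_\lambda$ (the semistandard PBW-tableaux of shape $\lambda$) and $\lambda$ runs over $P^+(d_1,\dots,d_s)$, form a basis of $Q^a(d_1,\dots,d_s)$ over $\mathbb C$.
   Context: $P^+(d_1,\dots,d_s)=\{m_1\omega_{d_1}+\dots+m_s\omega_{d_s}:m_i\in\mathbb Z_{\ge0}\}$, with $\omega_d$ the fundamental weights of $\mathfrak{sl}_n$. A weight $\sum_{i=1}^{n-1}m_i\omega_i$ is identified with the partition $\lambda=(m_1+\dots+m_{n-1},\,m_2+\dots+m_{n-1},\dots,m_{n-1})$ and its Young diagram $Y_\lambda$ (rows numbered top to bottom, columns left to right, box $(i,j)$ in row $i$, column $j$); $\mu_j$ is the length of the $j$-th column. For $\lambda\in P^+(d_1,\dots,d_s)$ all $\mu_j\in\{d_1,\dots,d_s\}$. A PBW-tableau of shape $\lambda$ is a filling of $Y_\lambda$ by numbers $T_{i,j}\in\{1,\dots,n\}$ such that: (1) if $T_{i,j}\le\mu_j$ then $T_{i,j}=i$; (2) if $i_1<i_2$ and $T_{i_1,j}\ne i_1$ then $T_{i_1,j}>T_{i_2,j}$. It is semistandard if moreover for every $j>1$ and every $i$ (with $(i,j)$ a box) there is $i_1\ge i$ with $T_{i_1,j-1}\ge T_{i,j}$.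 $ST^a_\lambda$ is the set of semistandard PBW-tableaux of shape $\lambda$. For a tableau $T$ of shape $\lambda$, $X^a_T=\prod_{j=1}^{\lambda_1}X^a_{T_{1,j},\dots,T_{\mu_j,j}}$. Polynomial ring: variables $X^a_{j_1,\dots,j_d}$ with $d\in\{d_1,\dots,d_s\}$, $1\le j_1<\dots<j_d\le n$, extended to arbitrary index sequences by being alternating in the indices (zero if an index repeats). Degenerate Plücker relations: for $p\ge q$ in $\{d_1,\dots,d_s\}$, $1\le k\le q$, and sequences $L=(l_1,\dots,l_p)$, $J=(j_1,\dots,j_q)$, each consisting of pairwise distinct elements of $\{1,\dots,n\}$ in arbitrary order, and for $\mathbf r=(1\le r_1<\dots<r_k\le p)$, let $L^{\mathbf r}$ be $L$ with the entry $l_{r_i}$ replaced by $j_i$ for $i=1,\dots,k$, and $J^{\mathbf r}=(l_{r_1},\dots,l_{r_k},j_{k+1},\dots,j_q)$. Then $$R^{k;a}_{L,J}=\varepsilon X^a_LX^a_J-\sum_{\mathbf r:\ \{l_{r_1},\dots,l_{r_k}\}\cap\{q+1,\dots,p\}=\emptyset}X^a_{L^{\mathbf r}}X^a_{J^{\mathbf r}},$$ where $\varepsilon=1$ if $\{j_1,\dots,j_k\}\cap\{q+1,\dots,p\}=\emptyset$ and $\varepsilon=0$ otherwise. $I^a(d_1,\dots,d_s)$ is generated by all $R^{k;a}_{L,J}$. *)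

theory Defs
  imports "HOL-Library.Poly_Mapping" "HOL-Library.FuncSet" "HOL-Algebra.QuotRing"
    "Jordan_Normal_Form.VS_Connect"
begin

text \<open>A weight \<open>\<Sum>k. m\<^sub>k \<omega>\<^sub>k\<close> of \<open>sl\<^sub>n\<close> is represented by its coefficient function \<open>k \<mapsto> m\<^sub>k\<close>;
  all weights considered are dominant, so natural number coefficients suffice.
  Throughout, \<open>D\<close> stands for \<open>{d\<^sub>1, \<dots>, d\<^sub>s}\<close>.\<close>

type_synonym weight = "nat \<Rightarrow> nat"

definition fundamental_weight :: "nat \<Rightarrow> weight" where
  "fundamental_weight d = (\<lambda>k. if k = d then 1 else 0)"

definition dominant_weights :: "nat set \<Rightarrow> weight set" where
  "dominant_weights D = {\<lambda>k. \<Sum>d\<in>D. m d * fundamental_weight d k |m. True}"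

definition row_length :: "nat \<Rightarrow> weight \<Rightarrow> nat \<Rightarrow> nat" where
  "row_length n lam i = (\<Sum>k=i..n - 1. lam k)"

definition young_diagram :: "nat \<Rightarrow> weight \<Rightarrow> (nat \<times> nat) set" where
  "young_diagram n lam = {(i, j). 1 \<le> i \<and> i \<le> n - 1 \<and> 1 \<le> j \<and> j \<le> row_length n lam i}"

definition column_length :: "nat \<Rightarrow> weight \<Rightarrow> nat \<Rightarrow> nat" where
  "column_length n lam j = card {i. (i, j) \<in> young_diagram n lam}"

text \<open>Fillings are extensional functions (\<^const>\<open>PiE\<close>), so that two tableaux of the same shape are
  equal iff they agree on all boxes.\<close>

definition pbw_tableaux :: "nat \<Rightarrow> weight \<Rightarrow> (nat \<times> nat \<Rightarrow> nat) set" where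
  "pbw_tableaux n lam = {T \<in> young_diagram n lam \<rightarrow>\<^sub>E {1..n}.
     (\<forall>(i, j) \<in> young_diagram n lam. T (i, j) \<le> column_length n lam j \<longrightarrow> T (i, j) = i) \<and>
     (\<forall>i1 i2 j. (i1, j) \<in> young_diagram n lam \<and> (i2, j) \<in> young_diagram n lam \<and>
        i1 < i2 \<and> T (i1, j) \<noteq> i1 \<longrightarrow> T (i1, j) > T (i2, j))}"

definition semistandard_pbw_tableaux :: "nat \<Rightarrow> weight \<Rightarrow> (nat \<times> nat \<Rightarrow> nat) set" where
  "semistandard_pbw_tableaux n lam = {T \<in> pbw_tableaux n lam.
     \<forall>(i, j) \<in> young_diagram n lam. j > 1 \<longrightarrow>
       (\<exists>i1\<ge>i. (i1, j - 1) \<in> young_diagram n lam \<and> T (i1, j - 1) \<ge> T (i, j))}"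

text \<open>The variable with increasing index sequence \<open>j\<^sub>1 < \<dots> < j\<^sub>d\<close> is indexed by the set
  \<open>{j\<^sub>1, \<dots>, j\<^sub>d}\<close>. Polynomials are finitely supported coefficient functions on monomials.\<close>

type_synonym plucker_poly = "(nat set \<Rightarrow>\<^sub>0 nat) \<Rightarrow>\<^sub>0 complex"

definition plucker_indices :: "nat \<Rightarrow> nat set \<Rightarrow> nat set set" where
  "plucker_indices n D = {A. A \<subseteq> {1..n} \<and> card A \<in> D}"

definition plucker_ring :: "nat \<Rightarrow> nat set \<Rightarrow> plucker_poly ring" where
  "plucker_ring n D = class_ring
     \<lparr>carrier := {f. \<forall>m \<in> Poly_Mapping.keys f. Poly_Mapping.keys m \<subseteq> plucker_indices n D}\<rparr>"

definition const_poly :: "complex \<Rightarrow> plucker_poly" where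
  "const_poly c = Poly_Mapping.single 0 c"

definition inversions :: "nat list \<Rightarrow> (nat \<times> nat) set" where
  "inversions L = {(a, b). a < b \<and> b < length L \<and> L ! a > L ! b}"

text \<open>\<open>X\<^sup>a\<close> for an arbitrary index sequence: the alternating extension of the variables.\<close>

definition plucker_var :: "nat list \<Rightarrow> plucker_poly" where
  "plucker_var L = (if distinct L
     then (- 1) ^ card (inversions L) * Poly_Mapping.single (Poly_Mapping.single (set L) 1) 1
     else 0)"

lemma plucker_var_adjacent_swap:
  assumes i: "Suc i < length L"
  shows "plucker_var (L[i := L ! Suc i, Suc i := L ! i]) = - plucker_var L"
proof (cases "distinct L")
  case True
  let ?L = "L[i := L ! Suc i, Suc i := L ! i]" and ?t = "Transposition.transpose i (Suc i)"
  have nth: "?L ! a = L ! ?t a" if "a < length L" for a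
    using i that by (auto simp: nth_list_update transpose_def)
  have t: "?t a < length L \<longleftrightarrow> a < length L" for a
    using i by (auto simp: transpose_def)
  have mono: "?t a < ?t b" if "a < b" "(a, b) \<noteq> (i, Suc i)" for a b
    using that by (auto simp: transpose_def)
  define p where "p = (i, Suc i)"
  have img: "map_prod ?t ?t ` (inversions L - {p}) = inversions ?L - {p}"
  proof (intro equalityI subsetI)
    fix x assume "x \<in> map_prod ?t ?t ` (inversions L - {p})"
    then obtain a b where ab: "x = (?t a, ?t b)" "(a, b) \<in> inversions L" "(a, b) \<noteq> (i, Suc i)"
      by (auto simp: p_def)
    then have "a < b" "b < length L" "a < length L" by (auto simp: inversions_def)
    with ab mono[of a b] t[of a] t[of b] nth[of "?t a"] nth[of "?t b"]
    show "x \<in> inversions ?L - {p}"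
      by (auto simp: inversions_def p_def transpose_eq_iff)
  next
    fix x assume x: "x \<in> inversions ?L - {p}"
    then obtain a b where ab: "x = (a, b)" "(a, b) \<in> inversions ?L" "(a, b) \<noteq> (i, Suc i)"
      by (cases x) (auto simp: p_def)
    then have *: "a < b" "b < length L" "a < length L" by (auto simp: inversions_def)
    with ab mono[of a b] t[of a] t[of b] nth[of a] nth[of b]
    have "(?t a, ?t b) \<in> inversions L - {p}"
      by (auto simp: inversions_def p_def transpose_eq_iff)
    then show "x \<in> map_prod ?t ?t ` (inversions L - {p})"
      by (intro image_eqI[of _ _ "(?t a, ?t b)"]) (simp_all add: ab)
  qed
  have "inj_on (map_prod ?t ?t) A" for A
    by (rule inj_onI) (auto simp: transpose_eq_iff)
  then have card: "card (inversions ?L - {p}) = card (inversions L - {p})"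
    unfolding img[symmetric] by (rule card_image)
  have fin: "finite (inversions M)" for M
    by (rule finite_subset[of _ "{..<length M} \<times> {..<length M}"]) (auto simp: inversions_def)
  have "L ! i \<noteq> L ! Suc i" using True i by (simp add: nth_eq_iff_index_eq)
  then have "p \<in> inversions ?L \<longleftrightarrow> p \<notin> inversions L"
    using i by (auto simp: inversions_def p_def)
  then have "card (inversions ?L) = Suc (card (inversions L)) \<or>
      card (inversions L) = Suc (card (inversions ?L))"
    using card fin[of L] fin[of ?L] card_Suc_Diff1[of _ p] by (metis Diff_empty Diff_insert0)
  then have "(- 1 :: plucker_poly) ^ card (inversions ?L) = - ((- 1) ^ card (inversions L))"
    by auto
  moreover have "distinct ?L" "set ?L = set L" using True i by simp_all
  ultimately show ?thesis using True by (simp add: plucker_var_def)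
qed (use i in \<open>simp add: plucker_var_def\<close>)

definition tableau_monomial :: "nat \<Rightarrow> weight \<Rightarrow> (nat \<times> nat \<Rightarrow> nat) \<Rightarrow> plucker_poly" where
  "tableau_monomial n lam T = (\<Prod>j=1..row_length n lam 1.
     plucker_var (map (\<lambda>i. T (i, j)) [1..<column_length n lam j + 1]))"

text \<open>Position sequences \<open>r\<close> are strictly increasing lists of positions in \<open>L\<close>, counted from 0.\<close>

definition exchange_left :: "nat list \<Rightarrow> nat list \<Rightarrow> nat list \<Rightarrow> nat list" where
  "exchange_left r L J = fold (\<lambda>i M. M[r ! i := J ! i]) [0..<length r] L"

definition exchange_right :: "nat list \<Rightarrow> nat list \<Rightarrow> nat list \<Rightarrow> nat list" where
  "exchange_right r L J = map (\<lambda>a. L ! a) r @ drop (length r) J"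

definition degenerate_plucker_relation :: "nat \<Rightarrow> nat list \<Rightarrow> nat list \<Rightarrow> plucker_poly" where
  "degenerate_plucker_relation k L J =
     (let p = length L; q = length J in
      (if set (take k J) \<inter> {q + 1..p} = {} then 1 else 0) * plucker_var L * plucker_var J
      - (\<Sum>r | length r = k \<and> sorted_wrt (<) r \<and> set r \<subseteq> {..<p} \<and>
               (\<lambda>a. L ! a) ` set r \<inter> {q + 1..p} = {}.
           plucker_var (exchange_left r L J) * plucker_var (exchange_right r L J)))"

definition degenerate_plucker_relations :: "nat \<Rightarrow> nat set \<Rightarrow> plucker_poly set" where
  "degenerate_plucker_relations n D = {degenerate_plucker_relation k L J |k L J.
     length L \<in> D \<and> length J \<in> D \<and> length J \<le> length L \<and> 1 \<le> k \<and> k \<le> length J \<and>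
     distinct L \<and> set L \<subseteq> {1..n} \<and> distinct J \<and> set J \<subseteq> {1..n}}"

definition degenerate_plucker_ideal :: "nat \<Rightarrow> nat set \<Rightarrow> plucker_poly set" where
  "degenerate_plucker_ideal n D = genideal (plucker_ring n D) (degenerate_plucker_relations n D)"

definition quotient_class :: "nat \<Rightarrow> nat set \<Rightarrow> plucker_poly \<Rightarrow> plucker_poly set" where
  "quotient_class n D f = degenerate_plucker_ideal n D +>\<^bsub>plucker_ring n D\<^esub> f"

definition degenerate_plucker_algebra :: "nat \<Rightarrow> nat set \<Rightarrow> (complex, plucker_poly set) module" where
  "degenerate_plucker_algebra n D =
     ring.extend (plucker_ring n D Quot degenerate_plucker_ideal n D)
       (module.fields (\<lambda>c A. quotient_class n D (const_poly c)
          \<otimes>\<^bsub>plucker_ring n D Quot degenerate_plucker_ideal n D\<^esub> A))"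

text \<open>The family is indexed by pairs (weight, tableau): the shape is not recoverable from the
  function representing the filling alone.\<close>

definition tableau_class :: "nat \<Rightarrow> nat set \<Rightarrow> weight \<times> (nat \<times> nat \<Rightarrow> nat) \<Rightarrow> plucker_poly set" where
  "tableau_class n D = (\<lambda>(lam, T). quotient_class n D (tableau_monomial n lam T))"

lemma plucker_ring_simps [simp]:
  "mult (plucker_ring n D) = (*)" "add (plucker_ring n D) = (+)"
  "zero (plucker_ring n D) = 0" "one (plucker_ring n D) = 1"
  by (simp_all add: plucker_ring_def)

lemma zero_in: "0 \<in> carrier (plucker_ring n D)"
  by (simp add: plucker_ring_def)

lemma const_in: "const_poly c \<in> carrier (plucker_ring n D)"
  by (auto simp: plucker_ring_def const_poly_def)

lemma one_in: "1 \<in> carrier (plucker_ring n D)"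
  by (simp add: plucker_ring_def)

lemma uminus_in: "f \<in> carrier (plucker_ring n D) \<Longrightarrow> - f \<in> carrier (plucker_ring n D)"
  by (simp add: plucker_ring_def in_keys_iff)

lemma add_in: "f \<in> carrier (plucker_ring n D) \<Longrightarrow> g \<in> carrier (plucker_ring n D)
    \<Longrightarrow> f + g \<in> carrier (plucker_ring n D)"
  using keys_add[of f g] by (fastforce simp: plucker_ring_def)

lemma diff_in: "f \<in> carrier (plucker_ring n D) \<Longrightarrow> g \<in> carrier (plucker_ring n D)
    \<Longrightarrow> f - g \<in> carrier (plucker_ring n D)"
  using add_in[of f n D "- g"] uminus_in[of g] by simp

lemma mult_in: "f \<in> carrier (plucker_ring n D) \<Longrightarrow> g \<in> carrier (plucker_ring n D)
    \<Longrightarrow> f * g \<in> carrier (plucker_ring n D)"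
proof -
  assume f: "f \<in> carrier (plucker_ring n D)" and g: "g \<in> carrier (plucker_ring n D)"
  show ?thesis unfolding plucker_ring_def
  proof (clarsimp)
    fix m A assume "m \<in> Poly_Mapping.keys (f * g)" and A: "A \<in> Poly_Mapping.keys m"
    then obtain a b where "a \<in> Poly_Mapping.keys f" "b \<in> Poly_Mapping.keys g" "m = a + b"
      using keys_mult[of f g] by blast
    with f g A keys_add[of a b] show "A \<in> plucker_indices n D"
      by (fastforce simp: plucker_ring_def)
  qed
qed

lemma sum_in: "(\<And>i. i \<in> S \<Longrightarrow> f i \<in> carrier (plucker_ring n D)) \<Longrightarrow>
    sum f S \<in> carrier (plucker_ring n D)"
  by (induction S rule: infinite_finite_induct) (auto simp: zero_in add_in)

lemma prod_in: "(\<And>i. i \<in> S \<Longrightarrow> f i \<in> carrier (plucker_ring n D)) \<Longrightarrow>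
    prod f S \<in> carrier (plucker_ring n D)"
  by (induction S rule: infinite_finite_induct) (auto simp: one_in mult_in)

lemma plucker_cring: "cring (plucker_ring n D)"
proof (rule cringI)
  show "abelian_group (plucker_ring n D)"
    by (rule abelian_groupI) (auto simp: add_in zero_in add.assoc add.commute
        intro!: bexI[of _ "- x" for x] uminus_in)
  show "Group.comm_monoid (plucker_ring n D)"
    by (rule comm_monoidI) (auto simp: mult_in one_in ac_simps)
qed (auto simp: algebra_simps)

lemma plucker_var_in:
  assumes "set L \<subseteq> {1..n}" "length L \<in> D"
  shows "plucker_var L \<in> carrier (plucker_ring n D)"
proof (cases "distinct L")
  case True
  have "Poly_Mapping.single (Poly_Mapping.single (set L) 1) 1 \<in> carrier (plucker_ring n D)"
    using assms True by (auto simp: plucker_ring_def plucker_indices_def distinct_card)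
  moreover have "(- 1) ^ k \<in> carrier (plucker_ring n D)" for k
    by (induction k) (auto simp: one_in uminus_in)
  ultimately show ?thesis using True by (simp add: plucker_var_def mult_in)
qed (simp add: plucker_var_def zero_in)

lemma exchange_left_facts:
  "length (exchange_left r L J) = length L"
  "length r \<le> length J \<Longrightarrow> set (exchange_left r L J) \<subseteq> set L \<union> set J"
proof -
  have "length (fold (\<lambda>i M. M[r ! i := J ! i]) [0..<k] L) = length L \<and>
    (k \<le> length J \<longrightarrow> set (fold (\<lambda>i M. M[r ! i := J ! i]) [0..<k] L) \<subseteq> set L \<union> set J)" for k
    by (induction k) (auto dest!: set_update_subset_insert[THEN subsetD])
  then show "length (exchange_left r L J) = length L"
    "length r \<le> length J \<Longrightarrow> set (exchange_left r L J) \<subseteq> set L \<union> set J"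
    by (auto simp: exchange_left_def)
qed

lemma relations_in: "degenerate_plucker_relations n D \<subseteq> carrier (plucker_ring n D)"
proof
  fix x assume "x \<in> degenerate_plucker_relations n D"
  then obtain k L J where x: "x = degenerate_plucker_relation k L J"
    and *: "length L \<in> D" "length J \<in> D" "length J \<le> length L" "k \<le> length J"
      "set L \<subseteq> {1..n}" "set J \<subseteq> {1..n}"
    by (auto simp: degenerate_plucker_relations_def)
  have "plucker_var (exchange_left r L J) * plucker_var (exchange_right r L J)
      \<in> carrier (plucker_ring n D)"
    if "length r = k" "set r \<subseteq> {..<length L}" for r
  proof (intro mult_in plucker_var_in)
    show "length (exchange_left r L J) \<in> D" "set (exchange_left r L J) \<subseteq> {1..n}"
      using * that exchange_left_facts(1)[of r L J]
        exchange_left_facts(2)[of r J L] by auto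
    show "length (exchange_right r L J) \<in> D"
      using * that by (simp add: exchange_right_def)
    have "(\<lambda>a. L ! a) ` set r \<subseteq> set L" using that by auto
    then show "set (exchange_right r L J) \<subseteq> {1..n}"
      using * set_drop_subset[of "length r" J] by (auto simp: exchange_right_def)
  qed
  then have "(\<Sum>r | length r = k \<and> sorted_wrt (<) r \<and> set r \<subseteq> {..<length L} \<and>
               (\<lambda>a. L ! a) ` set r \<inter> {length J + 1..length L} = {}.
           plucker_var (exchange_left r L J) * plucker_var (exchange_right r L J))
      \<in> carrier (plucker_ring n D)"
    by (intro sum_in) blast
  moreover have "plucker_var L \<in> carrier (plucker_ring n D)"
    "plucker_var J \<in> carrier (plucker_ring n D)"
    using * by (simp_all add: plucker_var_in)
  ultimately show "x \<in> carrier (plucker_ring n D)"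
    unfolding x degenerate_plucker_relation_def Let_def
    by (intro diff_in mult_in) (simp_all add: one_in zero_in)
qed

lemma degenerate_plucker_ideal_ideal: "ideal (degenerate_plucker_ideal n D) (plucker_ring n D)"
  unfolding degenerate_plucker_ideal_def
  by (intro ring.genideal_ideal relations_in cring.axioms(1)[OF plucker_cring])

lemma degenerate_plucker_algebra_vectorspace:
  "vectorspace class_ring (degenerate_plucker_algebra n D)"
proof -
  let ?R = "plucker_ring n D" and ?I = "degenerate_plucker_ideal n D"
  let ?Q = "?R Quot ?I" and ?A = "degenerate_plucker_algebra n D"
  interpret I: ideal ?I ?R by (rule degenerate_plucker_ideal_ideal)
  interpret Q: cring ?Q by (rule I.quotient_is_cring[OF plucker_cring])
  have [simp]: "carrier ?A = carrier ?Q" "mult ?A = mult ?Q" "one ?A = one ?Q"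
    "zero ?A = zero ?Q" "add ?A = add ?Q"
    "module.smult ?A = (\<lambda>c A. quotient_class n D (const_poly c) \<otimes>\<^bsub>?Q\<^esub> A)"
    by (simp_all add: degenerate_plucker_algebra_def ring.defs module.defs)
  have hom: "quotient_class n D \<in> Ring.ring_hom ?R ?Q"
    unfolding quotient_class_def by (rule I.rcos_ring_hom)
  have c: "const_poly (a + b) = const_poly a + const_poly b"
    "const_poly (a * b) = const_poly a * const_poly b" "const_poly 1 = 1" for a b
    by (simp_all add: const_poly_def single_add mult_single)
  have q: "quotient_class n D (const_poly a) \<in> carrier ?Q"
    "quotient_class n D (const_poly (a + b)) =
      quotient_class n D (const_poly a) \<oplus>\<^bsub>?Q\<^esub> quotient_class n D (const_poly b)"
    "quotient_class n D (const_poly (a * b)) =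
      quotient_class n D (const_poly a) \<otimes>\<^bsub>?Q\<^esub> quotient_class n D (const_poly b)"
    "quotient_class n D (const_poly 1) = \<one>\<^bsub>?Q\<^esub>" for a b
    using ring_hom_closed[OF hom const_in, of a] ring_hom_add[OF hom const_in const_in, of a b]
      ring_hom_mult[OF hom const_in const_in, of a b] ring_hom_one[OF hom]
    by (simp_all add: c)
  have "abelian_group ?A"
    by (rule abelian_groupI) (auto simp: Q.a_ac intro: Q.l_neg Q.a_inv_closed)
  then have "Module.module class_ring ?A"
    by (intro moduleI) (auto simp: q Q.l_distr Q.r_distr Q.m_assoc intro: class_cring.is_cring)
  then show ?thesis by (simp add: vectorspace_def class_field)
qed

end

theory Submission
  imports Defs "HOL-Combinatorics.Multiset_Permutations"
begin

text \<open>A PBW column with entry set \<open>A\<close> has heights \<open>h\<^sub>i = max {T\<^sub>j. j \<ge> i}\<close>, and two adjacent columns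
  violate semistandardness in row \<open>k\<close> when the right one has an entry larger than the left height \<open>h\<^sub>k\<close>.
  Exchanging its first \<open>k\<close> entries by the degenerate Pluecker relation only produces left columns with
  \<open>h\<^sub>k\<close> larger and no \<open>h\<^sub>i\<close> with \<open>i > k\<close> smaller; read lexicographically, this terminates, so the
  semistandard monomials span.

  For independence, send \<open>X\<^sup>a\<^sub>J\<close> with \<open>d\<close> indices to \<open>t\<^sub>d\<close> times the minor with rows \<open>J\<close> of the matrix whose
  row \<open>x\<close> is the unit vector \<open>e\<^sub>x\<close> for \<open>x \<le> d\<close> and \<open>(z\<^sub>x\<^sub>1, \<dots>, z\<^sub>x\<^sub>d)\<close> for \<open>x > d\<close>. These are coordinates on
  the open cell of the degenerate flag variety, and the relations vanish there by the exchange
  identity for determinants. For a suitable weight the minor of a PBW column has the product of its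
  entries \<open>z\<close> at \<open>(T\<^sub>i, i)\<close> as unique lightest term, and a semistandard tableau is recovered from the
  product of these terms: its first column consists of their maximal indices.\<close>

section \<open>The exchange identity for determinants\<close>

text \<open>The degenerate relations are ordinary exchange relations with some terms deleted, and
  truncation explains which. For q < x \<le> p, row x of the matrix of size p is a unit vector in a
  column beyond q, so it vanishes when only q columns are read; all other rows look alike in both
  sizes. The deleted terms, and the left product when \<epsilon> is 0, are determinants containing
  such a row. The exchange identity comes from iterating Cramer's rule, which chooses positions one
  after another; each set of k positions is met k! times, and this factor is cancelled only in the
  polynomial ring. Straightening gives no hold on the right column of an exchanged pair. Only the
  left one is measured, and the ranks of the columns are concatenated from left to right, so that
  its drop outweighs whatever happens after it.\<close>

definition rows_det :: "nat \<Rightarrow> (nat \<Rightarrow> nat \<Rightarrow> 'a::comm_ring_1) \<Rightarrow> 'a" where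
  "rows_det m f = Determinant.det (mat m m (\<lambda>(i, j). f i j))"

lemma rows_det_cong:
  assumes "\<And>i j. i < m \<Longrightarrow> j < m \<Longrightarrow> f i j = g i j"
  shows "rows_det m f = rows_det m g"
  unfolding rows_det_def by (rule arg_cong[where f = Determinant.det]) (auto simp: assms)

lemma rows_det_swap:
  assumes "a < m" "b < m" "a \<noteq> b"
  shows "rows_det m (f(a := f b, b := f a)) = - rows_det m f"
proof -
  have "mat m m (\<lambda>(i, j). (f(a := f b, b := f a)) i j) = swaprows a b (mat m m (\<lambda>(i, j). f i j))"
    using assms by (intro eq_matI) (auto simp: mat_swaprows_def)
  with det_swaprows[OF assms, of "mat m m (\<lambda>(i, j). f i j)"] show ?thesis
    by (simp add: rows_det_def)
qed

lemma rows_det_eq_rows: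
  assumes "a < m" "b < m" "a \<noteq> b" "\<And>j. j < m \<Longrightarrow> f a j = f b j"
  shows "rows_det m f = 0"
  unfolding rows_det_def
  by (rule det_identical_rows[where i = a and j = b]) (use assms in \<open>auto intro!: eq_vecI\<close>)

lemma rows_det_expand:
  assumes "k < m"
  shows "rows_det m (g(k := y)) = (\<Sum>j<m. y j * cofactor (mat m m (\<lambda>(i, j). g i j)) k j)"
proof -
  let ?A = "mat m m (\<lambda>(i, j). (g(k := y)) i j)" and ?B = "mat m m (\<lambda>(i, j). g i j)"
  have "mat_delete ?A k j = mat_delete ?B k j" for j
    by (rule eq_matI) (auto simp: mat_delete_def)
  then have "cofactor ?A k j = cofactor ?B k j" for j
    by (simp add: cofactor_def)
  with laplace_expansion_row[of ?A m k] assms show ?thesis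
    by (simp add: rows_det_def)
qed

lemma rows_det_zero_row:
  assumes "k < m" "\<And>j. j < m \<Longrightarrow> g k j = 0"
  shows "rows_det m g = 0"
  using rows_det_expand[OF assms(1), of g "g k"] assms(2) by simp

text \<open>Cramer's rule in rows: multiplying a matrix by its adjugate writes its determinant times
  any vector \<open>y\<close> as a combination of its rows, and by cofactor expansion the
  coefficient of row \<open>x\<close> is the determinant with that row replaced by
  \<open>y\<close>.\<close>

lemma cramer_rows:
  assumes "j < p"
  shows "(\<Sum>x<p. rows_det p (v(x := y)) * v x j) = rows_det p v * y j"
proof -
  let ?A = "mat p p (\<lambda>(i, j). v i j)"
  have adj: "(\<Sum>x<p. cofactor ?A x l * v x j) = (if l = j then rows_det p v else 0)" if "l < p" for l
  proof -
    have "(adj_mat ?A * ?A) $$ (l, j) = (\<Sum>x<p. cofactor ?A x l * v x j)"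
      using that assms by (simp add: adj_mat_def scalar_prod_def atLeast0LessThan)
    moreover have "(adj_mat ?A * ?A) $$ (l, j) = (if l = j then rows_det p v else 0)"
      using that assms by (subst adj_mat(3)[of _ p]) (auto simp: rows_det_def)
    ultimately show ?thesis by simp
  qed
  have "(\<Sum>x<p. rows_det p (v(x := y)) * v x j) =
      (\<Sum>x<p. \<Sum>l<p. y l * (cofactor ?A x l * v x j))"
    by (intro sum.cong) (simp_all add: rows_det_expand sum_distrib_right mult.assoc)
  also have "\<dots> = (\<Sum>l<p. y l * (\<Sum>x<p. cofactor ?A x l * v x j))"
    by (subst sum.swap) (simp add: sum_distrib_left)
  also have "\<dots> = (\<Sum>l<p. if l = j then y l * rows_det p v else 0)"
    by (intro sum.cong) (simp_all add: adj)
  finally show ?thesis using assms by (simp add: mult.commute)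
qed

text \<open>Both sides are linear in row \<open>k\<close> of the second matrix, so it suffices to
  compare the vectors put there, and Cramer's rule does this coordinate by coordinate.
  \<open>rows_det q\<close> reads only the first \<open>q\<close> coordinates, so rows of the larger
  matrix may enter it, and \<open>q \<le> p\<close> puts these coordinates within reach of Cramer's
  rule.\<close>

lemma exchange_single_row:
  assumes "k < q" "q \<le> p"
  shows "(\<Sum>x<p. rows_det p (v(x := y)) * rows_det q (g(k := v x))) =
    rows_det p v * rows_det q (g(k := y))"
proof -
  let ?c = "cofactor (mat q q (\<lambda>(i, j). g i j)) k"
  have "(\<Sum>x<p. rows_det p (v(x := y)) * rows_det q (g(k := v x))) =
      (\<Sum>x<p. \<Sum>j<q. (rows_det p (v(x := y)) * v x j) * ?c j)"
    by (simp add: rows_det_expand[OF assms(1)] sum_distrib_left mult.assoc)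
  also have "\<dots> = (\<Sum>j<q. (\<Sum>x<p. rows_det p (v(x := y)) * v x j) * ?c j)"
    by (subst sum.swap) (simp add: sum_distrib_right)
  also have "\<dots> = (\<Sum>j<q. (rows_det p v * y j) * ?c j)"
    by (intro sum.cong) (use assms in \<open>auto simp: cramer_rows\<close>)
  finally show ?thesis
    by (simp add: rows_det_expand[OF assms(1)] sum_distrib_left mult.assoc)
qed

section \<open>Exchanging several rows, summed over ordered choices of positions\<close>

definition replace_rows :: "nat list \<Rightarrow> (nat \<Rightarrow> 'a) \<Rightarrow> (nat \<Rightarrow> 'a) \<Rightarrow> nat \<Rightarrow> 'a" where
  "replace_rows r v w = fold (\<lambda>i u. u(r ! i := w i)) [0..<length r] v"

lemma replace_rows_snoc:
  "replace_rows (r @ [x]) v w = (replace_rows r v w)(x := w (length r))"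
proof -
  have "fold (\<lambda>i u. u((r @ [x]) ! i := w i)) [0..<length r] v =
      fold (\<lambda>i u. u(r ! i := w i)) [0..<length r] v"
    by (rule List.fold_cong) (auto simp: nth_append)
  then show ?thesis by (simp add: replace_rows_def)
qed

lemma replace_rows_notin: "x \<notin> set r \<Longrightarrow> replace_rows r v w x = v x"
proof (induction r rule: rev_induct)
  case (snoc a r)
  then show ?case by (simp add: replace_rows_snoc)
qed (simp add: replace_rows_def)

lemma replace_rows_nth: "distinct r \<Longrightarrow> i < length r \<Longrightarrow> replace_rows r v w (r ! i) = w i"
proof (induction r arbitrary: i rule: rev_induct)
  case (snoc a r)
  then show ?case by (cases "i = length r") (auto simp: replace_rows_snoc nth_append)
qed simp

lemma replace_rows_eqI:
  assumes "distinct r" "\<And>i. i < length r \<Longrightarrow> f (r ! i) = w i" "\<And>x. x \<notin> set r \<Longrightarrow> f x = v x"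
  shows "f = replace_rows r v w"
proof
  fix x show "f x = replace_rows r v w x"
    by (cases "x \<in> set r") (auto simp: assms replace_rows_nth replace_rows_notin in_set_conv_nth)
qed

definition position_lists :: "nat \<Rightarrow> nat \<Rightarrow> nat list set" where
  "position_lists k p = {r. length r = k \<and> distinct r \<and> set r \<subseteq> {..<p}}"

lemma finite_position_lists [simp]: "finite (position_lists k p)"
  by (rule finite_subset[OF _ finite_lists_length_eq[of "{..<p}" k]]) (auto simp: position_lists_def)

lemma sum_position_lists_Suc:
  "sum F (position_lists (Suc k) p) =
    (\<Sum>r\<in>position_lists k p. \<Sum>x\<in>{..<p} - set r. F (r @ [x]))"
proof -
  have "(\<Sum>r\<in>position_lists k p. \<Sum>x\<in>{..<p} - set r. F (r @ [x])) =
      (\<Sum>(r, x)\<in>(SIGMA r:position_lists k p. {..<p} - set r). F (r @ [x]))"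
    by (rule sum.Sigma) auto
  also have "\<dots> = sum F (position_lists (Suc k) p)"
  proof (rule sum.reindex_bij_witness[where i = "\<lambda>r. (butlast r, last r)" and j = "\<lambda>(r, x). r @ [x]"])
    fix r assume r: "r \<in> position_lists (Suc k) p"
    then have "r \<noteq> []" by (auto simp: position_lists_def)
    then obtain s x where "r = s @ [x]" by (metis append_butlast_last_id)
    with r show "(butlast r, last r) \<in> (SIGMA r:position_lists k p. {..<p} - set r)"
      "(case (butlast r, last r) of (r, x) \<Rightarrow> r @ [x]) = r"
      by (auto simp: position_lists_def)
  qed (auto simp: position_lists_def)
  finally show ?thesis by simp
qed

text \<open>The last position is chosen by a single-row exchange in the matrix that has already
  undergone \<open>k\<close> exchanges. That sum runs over all positions, so those already used must
  be subtracted. Each of the \<open>k\<close> of them accounts for the same total with opposite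
  sign, and the factor grows from \<open>k!\<close> to \<open>(k + 1)!\<close>.\<close>

lemma exchange_rows_injective:
  assumes "k \<le> q" "q \<le> p"
  shows "(\<Sum>r\<in>position_lists k p. rows_det p (replace_rows r v w) *
      rows_det q (\<lambda>i. if i < k then v (r ! i) else w i)) =
    fact k * (rows_det p v * rows_det q w)"
  using assms(1)
proof (induction k arbitrary: w)
  case 0
  have "position_lists 0 p = {[]}" by (auto simp: position_lists_def)
  then show ?case by (simp add: replace_rows_def)
next
  case (Suc k)
  let ?g = "\<lambda>r w i. if i < k then v (r ! i) else w i"
  let ?G = "\<lambda>r w. rows_det p (replace_rows r v w) * rows_det q (?g r w)"
  \<comment> \<open>Choosing \<open>r ! i\<close> again moves the row \<open>w i\<close>, put there
    earlier, into row \<open>k\<close> of the second matrix and puts \<open>w k\<close> in its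
    place. This is the exchange along \<open>r\<close> for \<open>w\<close> with its rows
    \<open>i\<close> and \<open>k\<close> swapped.\<close>
  let ?sw = "\<lambda>i. w(i := w k, k := w i)"
  have IH: "(\<Sum>r\<in>position_lists k p. ?G r w) = fact k * (rows_det p v * rows_det q w)" for w
    using Suc by simp
  have inner: "(\<Sum>x\<in>{..<p} - set r. rows_det p (replace_rows (r @ [x]) v w) *
        rows_det q (\<lambda>i. if i < Suc k then v ((r @ [x]) ! i) else w i)) =
      ?G r w - (\<Sum>i<k. ?G r (?sw i))" if r: "r \<in> position_lists k p" for r
  proof -
    have len: "length r = k" and dist: "distinct r" and sub: "set r \<subseteq> {..<p}"
      using r by (auto simp: position_lists_def)
    let ?v = "replace_rows r v w"
    let ?F = "\<lambda>x. rows_det p (?v(x := w k)) * rows_det q ((?g r w)(k := ?v x))"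
    have eq: "(?g r w)(k := w k) = ?g r w" by auto
    have "sum ?F {..<p} = ?G r w"
      using exchange_single_row[of k q p ?v "w k" "?g r w"] Suc.prems assms(2) by (simp add: eq)
    moreover have "sum ?F {..<p} = sum ?F ({..<p} - set r) + sum ?F (set r)"
      using sub by (intro sum.subset_diff) auto
    moreover have "sum ?F (set r) = (\<Sum>i<k. ?G r (?sw i))"
    proof -
      have "bij_betw ((!) r) {..<k} (set r)"
        using bij_betw_nth[OF dist] len by auto
      then have "sum ?F (set r) = (\<Sum>i<k. ?F (r ! i))"
        by (rule sum.reindex_bij_betw[symmetric])
      also have "\<dots> = (\<Sum>i<k. ?G r (?sw i))"
      proof (rule sum.cong)
        fix i assume "i \<in> {..<k}"
        then have i: "i < k" by simp
        have "?v(r ! i := w k) = replace_rows r v (?sw i)"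
          by (rule replace_rows_eqI)
            (use i len dist in \<open>auto simp: replace_rows_nth replace_rows_notin nth_eq_iff_index_eq\<close>)
        moreover have "(?g r w)(k := ?v (r ! i)) = ?g r (?sw i)"
          using i len dist by (auto simp: replace_rows_nth)
        ultimately show "?F (r ! i) = ?G r (?sw i)" by simp
      qed simp
      finally show ?thesis .
    qed
    moreover have "(\<Sum>x\<in>{..<p} - set r. rows_det p (replace_rows (r @ [x]) v w) *
        rows_det q (\<lambda>i. if i < Suc k then v ((r @ [x]) ! i) else w i)) = sum ?F ({..<p} - set r)"
    proof (rule sum.cong)
      fix x assume x: "x \<in> {..<p} - set r"
      have "(\<lambda>i. if i < Suc k then v ((r @ [x]) ! i) else w i) = (?g r w)(k := ?v x)"
        using x len by (auto simp: nth_append replace_rows_notin fun_eq_iff)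
      then show "rows_det p (replace_rows (r @ [x]) v w) *
          rows_det q (\<lambda>i. if i < Suc k then v ((r @ [x]) ! i) else w i) = ?F x"
        by (simp add: replace_rows_snoc len)
    qed simp
    ultimately show ?thesis by (simp add: algebra_simps)
  qed
  have sw: "rows_det q (?sw i) = - rows_det q w" if "i < k" for i
    by (rule rows_det_swap) (use that Suc.prems in auto)
  have "(\<Sum>r\<in>position_lists (Suc k) p. rows_det p (replace_rows r v w) *
      rows_det q (\<lambda>i. if i < Suc k then v (r ! i) else w i)) =
      (\<Sum>r\<in>position_lists k p. ?G r w - (\<Sum>i<k. ?G r (?sw i)))"
    by (subst sum_position_lists_Suc) (intro sum.cong inner refl)
  also have "\<dots> = (\<Sum>r\<in>position_lists k p. ?G r w) - (\<Sum>i<k. \<Sum>r\<in>position_lists k p. ?G r (?sw i))"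
    by (subst sum.swap) (simp add: sum_subtractf)
  also have "\<dots> = fact k * (rows_det p v * rows_det q w)
      - (\<Sum>i<k. fact k * (rows_det p v * rows_det q (?sw i)))"
    by (simp add: IH)
  also have "\<dots> = fact k * (rows_det p v * rows_det q w)
      + (\<Sum>i<k. fact k * (rows_det p v * rows_det q w))"
    by (simp add: sw sum_negf)
  also have "\<dots> = fact (Suc k) * (rows_det p v * rows_det q w)"
    by (simp add: algebra_simps)
  finally show ?case .
qed

section \<open>Passing from ordered choices of positions to sets of positions\<close>

lemma adjacent_sort_induct [consumes 1, case_names swap sorted]:
  fixes L :: "nat list"
  assumes "distinct L"
    and swap: "\<And>L i. distinct L \<Longrightarrow> Suc i < length L \<Longrightarrow> P (L[i := L ! Suc i, Suc i := L ! i]) \<Longrightarrow> P L"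
    and sorted: "P (sorted_list_of_set (set L))"
  shows "P L"
proof -
  define S where "S = set L"
  have "distinct L \<Longrightarrow> set L = S \<Longrightarrow> P L" for L
  \<comment> \<open>Position \<open>i\<close> carries the weight \<open>length L - i\<close>, so
    moving the smaller of two neighbours to the left lowers this sum.\<close>
  proof (induction "\<Sum>i<length L. (length L - i) * L ! i" arbitrary: L rule: less_induct)
    case less
    show ?case
    proof (cases "sorted L")
      case True
      with less.prems sorted show ?thesis
        by (metis S_def sorted_list_of_set.idem_if_sorted_distinct)
    next
      case False
      then obtain i where i: "Suc i < length L" "L ! i > L ! Suc i"
        by (auto simp: sorted_iff_nth_Suc)
      let ?M = "L[i := L ! Suc i, Suc i := L ! i]"
      have M: "distinct ?M" "set ?M = S" "length ?M = length L"
        using i less.prems by simp_all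
      have split: "{..<length L} = insert i (insert (Suc i) ({..<length L} - {i, Suc i}))"
        using i by auto
      have rest: "(\<Sum>x\<in>{..<length L} - {i, Suc i}. (length L - x) * ?M ! x) =
          (\<Sum>x\<in>{..<length L} - {i, Suc i}. (length L - x) * L ! x)"
        by (intro sum.cong) auto
      obtain d e where d: "length L = Suc i + Suc d" and e: "L ! i = Suc (L ! Suc i + e)"
        using i less_imp_Suc_add by (metis add.commute add_Suc_right)
      have "(length L - i) * L ! Suc i + (length L - Suc i) * L ! i <
          (length L - i) * L ! i + (length L - Suc i) * L ! Suc i"
        by (simp add: d e algebra_simps)
      then have "(\<Sum>i<length ?M. (length ?M - i) * ?M ! i) < (\<Sum>i<length L. (length L - i) * L ! i)"
        unfolding M(3) by (subst (1 2) split) (use i rest in simp)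
      from less.hyps[OF this M(1,2)] show ?thesis
        using swap less.prems(1) i(1) by blast
    qed
  qed
  with assms(1) S_def show ?thesis by blast
qed

lemma swap_replace_rows:
  assumes "distinct r" "Suc i < length r"
  shows "replace_rows (r[i := r ! Suc i, Suc i := r ! i]) v w =
    (replace_rows r v w)(r ! i := replace_rows r v w (r ! Suc i), r ! Suc i := replace_rows r v w (r ! i))"
    (is "replace_rows ?r v w = ?f")
proof (rule replace_rows_eqI[symmetric])
  show "distinct ?r" using assms by simp
  show "?f (?r ! a) = w a" if "a < length ?r" for a
    using that assms by (auto simp: nth_list_update nth_eq_iff_index_eq replace_rows_nth)
  show "?f x = v x" if "x \<notin> set ?r" for x
    using that assms by (auto simp: replace_rows_notin)
qed

text \<open>Swapping two neighbouring entries of \<open>r\<close> swaps two rows in each of the two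
  determinants. The signs cancel, so the product depends only on the set of positions.\<close>

lemma exchange_summand_sorted:
  assumes "distinct r" "set r \<subseteq> {..<p}" "length r \<le> q"
  shows "rows_det p (replace_rows r v w) * rows_det q (\<lambda>i. if i < length r then v (r ! i) else w i) =
    rows_det p (replace_rows (sorted_list_of_set (set r)) v w) *
    rows_det q (\<lambda>i. if i < length r then v (sorted_list_of_set (set r) ! i) else w i)"
  (is "?F r = ?R")
proof -
  define S l R where "S = set r" and "l = length r" and "R = ?R"
  have "set r = S \<Longrightarrow> length r = l \<Longrightarrow> ?F r = R"
    using assms(1)
  proof (induction r rule: adjacent_sort_induct)
    case (swap L i)
    let ?L = "L[i := L ! Suc i, Suc i := L ! i]"
    let ?g = "\<lambda>j. if j < length L then v (L ! j) else w j"
    have "L ! i \<in> set L" "L ! Suc i \<in> set L" using swap by auto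
    then have pq: "L ! i < p" "L ! Suc i < p" "Suc i < q"
      using swap assms by (auto simp: S_def l_def)
    have ne: "L ! i \<noteq> L ! Suc i" using swap by (simp add: nth_eq_iff_index_eq)
    have "(\<lambda>j. if j < length L then v (?L ! j) else w j) = ?g(i := ?g (Suc i), Suc i := ?g i)"
      using swap by (auto simp: fun_eq_iff nth_list_update)
    then have "rows_det q (\<lambda>j. if j < length L then v (?L ! j) else w j) = - rows_det q ?g"
      using rows_det_swap[of i q "Suc i" ?g] pq by simp
    moreover have "rows_det p (replace_rows ?L v w) = - rows_det p (replace_rows L v w)"
      using rows_det_swap[OF pq(1,2) ne, of "replace_rows L v w"] swap(1,2)
      by (simp only: swap_replace_rows)
    ultimately have "?F ?L = ?F L" by simp
    moreover have "?F ?L = R" using swap by simp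
    ultimately show ?case by simp
  next
    case sorted
    then show ?case using assms(1) by (simp add: S_def l_def R_def distinct_card)
  qed
  then show ?thesis by (simp add: S_def l_def R_def)
qed

text \<open>Every set of \<open>k\<close> positions is listed by \<open>k!\<close> injective
  sequences with equal summands. The factor stays on both sides until the identity is used for
  polynomials, where \<open>k!\<close> is invertible.\<close>

lemma exchange_rows:
  assumes "k \<le> q" "q \<le> p"
  shows "fact k * (\<Sum>r | length r = k \<and> sorted_wrt (<) r \<and> set r \<subseteq> {..<p}.
      rows_det p (replace_rows r v w) * rows_det q (\<lambda>i. if i < k then v (r ! i) else w i)) =
    fact k * (rows_det p v * rows_det q w)"
proof -
  let ?F = "\<lambda>r. rows_det p (replace_rows r v w) * rows_det q (\<lambda>i. if i < k then v (r ! i) else w i)"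
  let ?S = "{R. R \<subseteq> {..<p} \<and> card R = k}"
  have "(\<Sum>R\<in>?S. sum ?F {r \<in> position_lists k p. set r = R}) = sum ?F (position_lists k p)"
    by (rule sum.group[OF finite_position_lists]) (auto simp: position_lists_def distinct_card)
  moreover have "sum ?F {r \<in> position_lists k p. set r = R} = fact k * ?F (sorted_list_of_set R)"
    if "R \<in> ?S" for R
  proof -
    have fin: "finite R" using that finite_subset by auto
    have eq: "{r \<in> position_lists k p. set r = R} = permutations_of_set R"
      using that by (auto simp: position_lists_def permutations_of_set_def distinct_card)
    have "sum ?F {r \<in> position_lists k p. set r = R} = (\<Sum>r\<in>permutations_of_set R. ?F (sorted_list_of_set R))"
      unfolding eq
    proof (intro sum.cong refl)
      fix r assume "r \<in> permutations_of_set R"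
      then have "distinct r" "set r = R" "length r = k"
        using that by (auto simp: permutations_of_set_def distinct_card)
      with exchange_summand_sorted[of r p q v w] that assms
      have "?F r = ?F (sorted_list_of_set (set r))" by simp
      then show "?F r = ?F (sorted_list_of_set R)" by (simp only: \<open>set r = R\<close>)
    qed
    then show ?thesis using that fin by simp
  qed
  ultimately have "sum ?F (position_lists k p) = fact k * (\<Sum>R\<in>?S. ?F (sorted_list_of_set R))"
    by (simp add: sum_distrib_left)
  also have "(\<Sum>R\<in>?S. ?F (sorted_list_of_set R)) =
      sum ?F {r. length r = k \<and> sorted_wrt (<) r \<and> set r \<subseteq> {..<p}}"
  proof (rule sum.reindex_bij_witness[where i = set and j = sorted_list_of_set])
    fix R assume R: "R \<in> ?S"
    then have "finite R" using finite_subset by auto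
    with R show "set (sorted_list_of_set R) = R"
      "sorted_list_of_set R \<in> {r. length r = k \<and> sorted_wrt (<) r \<and> set r \<subseteq> {..<p}}" by auto
  next
    fix r :: "nat list" assume r: "r \<in> {r. length r = k \<and> sorted_wrt (<) r \<and> set r \<subseteq> {..<p}}"
    then have *: "sorted r" "distinct r" by (auto simp: strict_sorted_iff)
    then show "sorted_list_of_set (set r) = r"
      by (simp add: sorted_list_of_set.idem_if_sorted_distinct)
    show "set r \<in> ?S" using r * by (simp add: distinct_card)
  qed simp
  finally show ?thesis using exchange_rows_injective[OF assms, of v w] by simp
qed

section \<open>PBW columns and tableaux\<close>

text \<open>Lists count from 0: \<open>c ! i\<close> is the entry in row \<open>i + 1\<close>, hence
  \<open>Suc i\<close> where the tableau conditions have the row number.\<close>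

definition pbw_column :: "nat \<Rightarrow> nat list \<Rightarrow> bool" where
  "pbw_column n c \<longleftrightarrow> set c \<subseteq> {1..n} \<and> (\<forall>i<length c. c ! i \<le> length c \<longrightarrow> c ! i = Suc i) \<and>
    (\<forall>i j. i < j \<and> j < length c \<and> c ! i \<noteq> Suc i \<longrightarrow> c ! i > c ! j)"

definition dominates :: "nat list \<Rightarrow> nat list \<Rightarrow> bool" where
  "dominates c c' \<longleftrightarrow> length c' \<le> length c \<and>
    (\<forall>i<length c'. \<exists>i1. i \<le> i1 \<and> i1 < length c \<and> c' ! i \<le> c ! i1)"

text \<open>\<open>sorted_wrt\<close> relates all pairs of columns, so the first column dominates
  every other one; as \<open>dominates\<close> is transitive, this asks no more than the condition
  on neighbours. The column lengths carry the weight, so one list stands for a pair of weight and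
  filling.\<close>

definition standard_columns :: "nat \<Rightarrow> nat set \<Rightarrow> nat list list set" where
  "standard_columns n D = {cs. (\<forall>c\<in>set cs. pbw_column n c \<and> length c \<in> D) \<and> sorted_wrt dominates cs}"

definition tableau_columns :: "nat \<Rightarrow> weight \<Rightarrow> (nat \<times> nat \<Rightarrow> nat) \<Rightarrow> nat list list" where
  "tableau_columns n lam T = map (\<lambda>j. map (\<lambda>i. T (i, j)) [1..<column_length n lam j + 1])
     [1..<row_length n lam 1 + 1]"

lemma pbw_column_ge:
  assumes "pbw_column n c" "i < length c"
  shows "Suc i \<le> c ! i"
proof (cases "c ! i \<le> length c")
  case False
  then show ?thesis using assms(2) by simp
qed (use assms in \<open>auto simp: pbw_column_def\<close>)

text \<open>An entry that differs from its row number exceeds everything below it. An entry equal to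
  its row number is smaller than everything below it, since no entry falls short of its row
  number.\<close>

lemma pbw_column_distinct:
  assumes c: "pbw_column n c"
  shows "distinct c"
proof -
  have "c ! i \<noteq> c ! j" if "i < j" "j < length c" for i j
  proof (cases "c ! i = Suc i")
    case True
    then show ?thesis using c that pbw_column_ge[OF c, of j] by simp
  next
    case False
    then have "c ! i > c ! j" using c that by (auto simp: pbw_column_def)
    then show ?thesis by simp
  qed
  then show ?thesis unfolding distinct_conv_nth by (metis nat_neq_iff)
qed

lemma dominates_trans:
  assumes "dominates a b" "dominates b c"
  shows "dominates a c"
  unfolding dominates_def
proof (intro conjI allI impI)
  show "length c \<le> length a" using assms by (simp add: dominates_def)
  fix i assume "i < length c"
  with assms(2) obtain i1 where 1: "i \<le> i1" "i1 < length b" "c ! i \<le> b ! i1"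
    by (auto simp: dominates_def)
  with assms(1) obtain i2 where "i1 \<le> i2" "i2 < length a" "b ! i1 \<le> a ! i2"
    by (auto simp: dominates_def)
  with 1 show "\<exists>i1. i \<le> i1 \<and> i1 < length a \<and> c ! i \<le> a ! i1"
    by (intro exI[of _ i2]) simp
qed

lemma sorted_wrt_dominatesI:
  assumes "\<And>j. Suc j < length cs \<Longrightarrow> dominates (cs ! j) (cs ! Suc j)"
  shows "sorted_wrt dominates cs"
proof -
  have "transp dominates" by (rule transpI) (rule dominates_trans)
  with assms show ?thesis
    by (simp add: sorted_wrt_iff_nth_Suc_transp)
qed

lemma tableau_monomial_columns:
  "tableau_monomial n lam T = prod_list (map plucker_var (tableau_columns n lam T))"
proof -
  let ?g = "\<lambda>j. plucker_var (map (\<lambda>i. T (i, j)) [1..<column_length n lam j + 1])"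
  have "{1..row_length n lam 1} = set [1..<row_length n lam 1 + 1]" by auto
  then have "tableau_monomial n lam T = prod ?g (set [1..<row_length n lam 1 + 1])"
    unfolding tableau_monomial_def by (simp only:)
  also have "\<dots> = prod_list (map ?g [1..<row_length n lam 1 + 1])"
    by (rule prod.distinct_set_conv_list) (rule distinct_upt)
  finally show ?thesis by (simp add: tableau_columns_def comp_def del: upt_Suc)
qed

section \<open>Young diagrams: row lengths, column lengths and the weight\<close>

lemma row_length_antimono: "i \<le> i' \<Longrightarrow> row_length n lam i' \<le> row_length n lam i"
  unfolding row_length_def by (rule sum_mono2) auto

lemma downward_closed_eq_atLeastAtMost:
  fixes S :: "nat set"
  assumes "finite S" "0 \<notin> S" "\<And>i i'. i \<in> S \<Longrightarrow> 1 \<le> i' \<Longrightarrow> i' \<le> i \<Longrightarrow> i' \<in> S"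
  shows "S = {1..card S}"
proof (cases "S = {}")
  case False
  then have "Max S \<in> S" using assms(1) by simp
  have "S = {1..Max S}"
  proof (intro equalityI subsetI)
    fix x assume "x \<in> S"
    then show "x \<in> {1..Max S}" using assms(1,2) by (cases x) auto
  qed (use assms(3) \<open>Max S \<in> S\<close> in auto)
  then show ?thesis by (metis card_atLeastAtMost diff_Suc_1)
qed simp

text \<open>Row lengths weakly decrease downwards, so the rows met by column \<open>j\<close> are
  closed under going up and form an interval that starts at 1.\<close>

lemma mem_young_diagram_iff:
  "(i, j) \<in> young_diagram n lam \<longleftrightarrow> 1 \<le> j \<and> 1 \<le> i \<and> i \<le> column_length n lam j"
proof -
  let ?S = "{i. (i, j) \<in> young_diagram n lam}"
  have "?S = {1..card ?S}"
  proof (rule downward_closed_eq_atLeastAtMost)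
    show "finite ?S" by (rule finite_subset[of _ "{..n}"]) (auto simp: young_diagram_def)
    show "i' \<in> ?S" if "i \<in> ?S" "1 \<le> i'" "i' \<le> i" for i i'
      using that row_length_antimono[of i' i n lam] by (auto simp: young_diagram_def)
  qed (auto simp: young_diagram_def)
  then have "i \<in> ?S \<longleftrightarrow> 1 \<le> i \<and> i \<le> column_length n lam j"
    unfolding column_length_def by (metis atLeastAtMost_iff)
  moreover have "(i, j) \<in> young_diagram n lam \<Longrightarrow> 1 \<le> j" by (simp add: young_diagram_def)
  ultimately show ?thesis by blast
qed

lemma young_diagram_conjugate:
  assumes "1 \<le> i" "i \<le> n - 1" "1 \<le> j"
  shows "i \<le> column_length n lam j \<longleftrightarrow> j \<le> row_length n lam i"
  using mem_young_diagram_iff[of i j n lam] assms by (auto simp: young_diagram_def)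

lemma column_length_le: "column_length n lam j \<le> n - 1"
proof (rule ccontr)
  assume a: "\<not> ?thesis"
  have "column_length n lam j \<le> card {1..n - 1}"
    unfolding column_length_def by (rule card_mono) (auto simp: young_diagram_def)
  then show False using a by simp
qed

lemma column_length_pos: "1 \<le> column_length n lam j" if "1 \<le> j" "j \<le> row_length n lam 1"
proof -
  have "1 \<le> n - 1"
  proof (rule ccontr)
    assume "\<not> 1 \<le> n - 1"
    then have "row_length n lam 1 = 0" by (simp add: row_length_def)
    with that show False by simp
  qed
  then show ?thesis using that young_diagram_conjugate[of 1 n j lam] by simp
qed

lemma length_tableau_columns [simp]: "length (tableau_columns n lam T) = row_length n lam 1"
  by (simp add: tableau_columns_def)

lemma nth_tableau_columns:
  assumes "j < row_length n lam 1"
  shows "tableau_columns n lam T ! j = map (\<lambda>i. T (i, Suc j)) [1..<Suc (column_length n lam (Suc j))]"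
  using assms by (simp add: tableau_columns_def del: upt_Suc)

lemma tableau_columns_nth_nth:
  assumes "j < row_length n lam 1" "i < column_length n lam (Suc j)"
  shows "tableau_columns n lam T ! j ! i = T (Suc i, Suc j)"
  using assms by (simp add: nth_tableau_columns del: upt_Suc)

lemma length_nth_tableau_columns:
  "j < row_length n lam 1 \<Longrightarrow> length (tableau_columns n lam T ! j) = column_length n lam (Suc j)"
  by (simp add: nth_tableau_columns)

lemma dominant_weights_iff:
  assumes "finite D"
  shows "lam \<in> dominant_weights D \<longleftrightarrow> (\<forall>k. k \<notin> D \<longrightarrow> lam k = 0)"
proof -
  have eq: "(\<Sum>d\<in>D. m d * fundamental_weight d k) = (if k \<in> D then m k else 0)" for m k
    using assms by (simp add: fundamental_weight_def if_distrib[of "(*) _"] cong: if_cong)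
  show ?thesis
  proof
    assume "lam \<in> dominant_weights D"
    then show "\<forall>k. k \<notin> D \<longrightarrow> lam k = 0" by (auto simp: dominant_weights_def eq)
  next
    assume "\<forall>k. k \<notin> D \<longrightarrow> lam k = 0"
    then have "lam = (\<lambda>k. \<Sum>d\<in>D. lam d * fundamental_weight d k)" by (auto simp: eq)
    then show "lam \<in> dominant_weights D" by (auto simp: dominant_weights_def)
  qed
qed

lemma row_length_Suc:
  assumes "i \<le> n - 1"
  shows "row_length n lam i = lam i + row_length n lam (Suc i)"
  using assms by (simp add: row_length_def sum.atLeast_Suc_atMost)

lemma row_length_eq_length_filter:
  assumes "1 \<le> i" "i \<le> n - 1"
  shows "row_length n lam i = length (filter (\<lambda>c. i \<le> length c) (tableau_columns n lam T))"
proof -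
  have "length (filter (\<lambda>c. i \<le> length c) (tableau_columns n lam T)) =
      card {j. j < row_length n lam 1 \<and> i \<le> column_length n lam (Suc j)}"
    unfolding length_filter_conv_card
    by (rule arg_cong[where f = card]) (auto simp: length_nth_tableau_columns)
  also have "{j. j < row_length n lam 1 \<and> i \<le> column_length n lam (Suc j)} = {..<row_length n lam i}"
    using young_diagram_conjugate[OF assms] row_length_antimono[OF assms(1), of n lam] by auto
  finally show ?thesis by simp
qed

text \<open>If the weight has coefficient 0 at \<open>k\<close>, rows \<open>k\<close> and
  \<open>k + 1\<close> have equal length, so a column that reaches row \<open>k\<close> also reaches
  row \<open>k + 1\<close> and cannot end in row \<open>k\<close>.\<close>

lemma column_length_in:
  assumes "finite D" "lam \<in> dominant_weights D" "1 \<le> j" "j \<le> row_length n lam 1"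
  shows "column_length n lam j \<in> D"
proof (rule ccontr)
  let ?k = "column_length n lam j"
  assume "?k \<notin> D"
  then have 0: "lam ?k = 0" using assms(1,2) by (simp add: dominant_weights_iff)
  have k: "1 \<le> ?k" "?k \<le> n - 1" using assms column_length_pos column_length_le by auto
  then have "j \<le> row_length n lam ?k" using young_diagram_conjugate[of ?k n j lam] assms(3) by simp
  then have j: "j \<le> row_length n lam (Suc ?k)" using row_length_Suc[OF k(2), of lam] 0 by simp
  have "Suc ?k \<le> n - 1"
  proof (rule ccontr)
    assume "\<not> Suc ?k \<le> n - 1"
    then have "row_length n lam (Suc ?k) = 0" by (simp add: row_length_def)
    with j assms(3) show False by simp
  qed
  then show False using young_diagram_conjugate[of "Suc ?k" n j lam] j assms(3) by simp
qed

lemma tableau_columns_standard: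
  assumes "finite D" "lam \<in> dominant_weights D" "T \<in> semistandard_pbw_tableaux n lam"
  shows "tableau_columns n lam T \<in> standard_columns n D"
proof -
  let ?cs = "tableau_columns n lam T"
  have T1: "T (i, j) \<in> {1..n}" if "(i, j) \<in> young_diagram n lam" for i j
    using assms(3) that by (auto simp: semistandard_pbw_tableaux_def pbw_tableaux_def)
  have T2: "T (i, j) = i" if "(i, j) \<in> young_diagram n lam" "T (i, j) \<le> column_length n lam j" for i j
    using assms(3) that by (auto simp: semistandard_pbw_tableaux_def pbw_tableaux_def)
  have T3: "T (i1, j) > T (i2, j)" if "(i1, j) \<in> young_diagram n lam" "(i2, j) \<in> young_diagram n lam"
    "i1 < i2" "T (i1, j) \<noteq> i1" for i1 i2 j
    using assms(3) that by (auto simp: semistandard_pbw_tableaux_def pbw_tableaux_def)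
  have T4: "\<exists>i1\<ge>i. (i1, j - 1) \<in> young_diagram n lam \<and> T (i1, j - 1) \<ge> T (i, j)"
    if "(i, j) \<in> young_diagram n lam" "j > 1" for i j
    using assms(3) that by (auto simp: semistandard_pbw_tableaux_def)
  have "pbw_column n c \<and> length c \<in> D" if c: "c \<in> set ?cs" for c
  proof -
    obtain j where "j < length ?cs" "c = ?cs ! j"
      using c unfolding in_set_conv_nth by blast
    then have j: "j < row_length n lam 1" "c = ?cs ! j" by simp_all
    have len: "length c = column_length n lam (Suc j)"
      using j by (simp add: length_nth_tableau_columns)
    have nth: "c ! i = T (Suc i, Suc j)" if "i < length c" for i
      using that j len by (simp add: tableau_columns_nth_nth)
    have box: "(Suc i, Suc j) \<in> young_diagram n lam" if "i < length c" for i
      using that len by (simp add: mem_young_diagram_iff)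
    have "set c \<subseteq> {1..n}"
      using T1[OF box] nth by (auto simp: in_set_conv_nth)
    moreover have "c ! i = Suc i" if "i < length c" "c ! i \<le> length c" for i
      using T2[OF box] nth len that by simp
    moreover have "c ! i > c ! i'" if "i < i'" "i' < length c" "c ! i \<noteq> Suc i" for i i'
      using T3[OF box[of i] box[of i']] that by (simp add: nth)
    ultimately have "pbw_column n c" by (simp add: pbw_column_def)
    moreover have "length c \<in> D" using column_length_in[OF assms(1,2), of "Suc j" n] j len by simp
    ultimately show ?thesis by simp
  qed
  moreover have "sorted_wrt dominates ?cs"
  proof (rule sorted_wrt_dominatesI)
    fix j assume "Suc j < length ?cs"
    then have j: "Suc j < row_length n lam 1" "j < row_length n lam 1" by simp_all
    have "\<exists>i1. i \<le> i1 \<and> i1 < length (?cs ! j) \<and> ?cs ! Suc j ! i \<le> ?cs ! j ! i1"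
      if i: "i < length (?cs ! Suc j)" for i
    proof -
      have i': "i < column_length n lam (Suc (Suc j))" using i j by (simp add: length_nth_tableau_columns)
      then have "(Suc i, Suc (Suc j)) \<in> young_diagram n lam" by (simp add: mem_young_diagram_iff)
      then obtain i1 where i1: "Suc i \<le> i1" "(i1, Suc j) \<in> young_diagram n lam"
        "T (Suc i, Suc (Suc j)) \<le> T (i1, Suc j)"
        using T4[of "Suc i" "Suc (Suc j)"] by auto
      then have "i1 - 1 < column_length n lam (Suc j)" by (simp add: mem_young_diagram_iff)
      with i1 i' j show ?thesis
        by (intro exI[of _ "i1 - 1"]) (auto simp: length_nth_tableau_columns tableau_columns_nth_nth)
    qed
    moreover have "length (?cs ! Suc j) \<le> length (?cs ! j)"
    proof -
      let ?k = "column_length n lam (Suc (Suc j))"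
      have "1 \<le> ?k" "?k \<le> n - 1" using column_length_pos column_length_le j by auto
      then have "Suc (Suc j) \<le> row_length n lam ?k"
        using young_diagram_conjugate[of ?k n "Suc (Suc j)" lam] by simp
      then have "?k \<le> column_length n lam (Suc j)"
        using young_diagram_conjugate[of ?k n "Suc j" lam] \<open>1 \<le> ?k\<close> \<open>?k \<le> n - 1\<close> by simp
      then show ?thesis using j by (simp add: length_nth_tableau_columns)
    qed
    ultimately show "dominates (?cs ! j) (?cs ! Suc j)" by (simp add: dominates_def)
  qed
  ultimately show ?thesis by (simp add: standard_columns_def)
qed

text \<open>The length of row \<open>i\<close> counts the columns of length at least
  \<open>i\<close>, and for \<open>k\<close> in \<open>D\<close> the coefficient of the weight is
  the difference of the lengths of rows \<open>k\<close> and \<open>k + 1\<close>.\<close>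

lemma tableau_columns_inj:
  assumes D: "D \<subseteq> {1..n - 1}"
    and lam: "lam \<in> dominant_weights D" and T: "T \<in> pbw_tableaux n lam"
    and lam': "lam' \<in> dominant_weights D" and T': "T' \<in> pbw_tableaux n lam'"
    and eq: "tableau_columns n lam T = tableau_columns n lam' T'"
  shows "lam = lam' \<and> T = T'"
proof -
  have fin: "finite D" using D finite_subset by blast
  have row: "row_length n lam i = row_length n lam' i" if "1 \<le> i" "i \<le> n - 1" for i
    using row_length_eq_length_filter[OF that, of lam T] row_length_eq_length_filter[OF that, of lam' T'] eq
    by simp
  have row': "row_length n lam i = row_length n lam' i" if "1 \<le> i" for i
    using row[OF that] by (cases "i \<le> n - 1") (auto simp: row_length_def)
  have "lam k = lam' k" for k
  proof (cases "k \<in> D")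
    case True
    then show ?thesis using D row'[of k] row'[of "Suc k"] row_length_Suc[of k n lam]
        row_length_Suc[of k n lam'] by auto
  qed (use lam lam' fin in \<open>auto simp: dominant_weights_iff\<close>)
  then have l: "lam = lam'" by auto
  have "T = T'"
  proof (rule PiE_ext)
    show "T \<in> young_diagram n lam \<rightarrow>\<^sub>E {1..n}" "T' \<in> young_diagram n lam \<rightarrow>\<^sub>E {1..n}"
      using T T' l by (auto simp: pbw_tableaux_def)
    fix x assume x: "x \<in> young_diagram n lam"
    obtain a b where ab: "x = (a, b)" by (cases x)
    then have "1 \<le> a" "1 \<le> b" using x by (auto simp: young_diagram_def)
    then obtain i j where ij: "x = (Suc i, Suc j)"
      using ab by (metis One_nat_def Suc_le_D)
    have "i < column_length n lam (Suc j)" using x ij by (simp add: mem_young_diagram_iff)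
    moreover have "j < row_length n lam 1"
      using x ij row_length_antimono[of 1 "Suc i" n lam] by (auto simp: young_diagram_def)
    ultimately show "T x = T' x"
      using eq l ij tableau_columns_nth_nth by metis
  qed
  with l show ?thesis by simp
qed

lemma sum_length_filter:
  assumes "finite A"
  shows "(\<Sum>k\<in>A. length (filter (\<lambda>c. length c = k) cs)) = length (filter (\<lambda>c. length c \<in> A) cs)"
  using assms
proof (induction cs)
  case (Cons c cs)
  have "(\<Sum>k\<in>A. length (filter (\<lambda>c. length c = k) (c # cs))) =
      (\<Sum>k\<in>A. (if k = length c then 1 else 0) + length (filter (\<lambda>c. length c = k) cs))"
    by (intro sum.cong) auto
  then show ?case using Cons by (simp add: sum.distrib)
qed simp

text \<open>Lengths weakly decrease along the list, so the columns of length at least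
  \<open>i\<close> form an initial segment.\<close>

lemma nth_filter_length_iff:
  assumes "sorted_wrt (\<lambda>c c'. length c' \<le> length c) cs" "j < length cs"
  shows "j < length (filter (\<lambda>c. i \<le> length c) cs) \<longleftrightarrow> i \<le> length (cs ! j)"
  using assms
proof (induction cs arbitrary: j)
  case (Cons c cs)
  show ?case
  proof (cases "i \<le> length c")
    case True
    then show ?thesis using Cons by (cases j) auto
  next
    case False
    then have "\<forall>x\<in>set (c # cs). \<not> i \<le> length x" using Cons.prems(1) by auto
    moreover from this have "filter (\<lambda>c. i \<le> length c) (c # cs) = []" by (simp add: filter_False)
    ultimately show ?thesis using Cons.prems(2) by (metis length_0_conv not_less_zero nth_mem)
  qed
qed simp

lemma tableau_columns_surj:
  assumes D: "D \<subseteq> {1..n - 1}" and cs: "cs \<in> standard_columns n D"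
  shows "\<exists>lam T. lam \<in> dominant_weights D \<and> T \<in> semistandard_pbw_tableaux n lam \<and> tableau_columns n lam T = cs"
proof -
  define lam where "lam k = length (filter (\<lambda>c. length c = k) cs)" for k
  \<comment> \<open>Both indices shift from boxes counted from 1 to lists counted from 0. The value
    \<open>undefined\<close> off the diagram makes the filling extensional.\<close>
  define T where "T = (\<lambda>(i, j). if (i, j) \<in> young_diagram n lam then cs ! (j - 1) ! (i - 1) else undefined)"
  have fin: "finite D" using D finite_subset by blast
  have col: "pbw_column n c" "length c \<in> D" "1 \<le> length c" "length c \<le> n - 1" if "c \<in> set cs" for c
  proof -
    show "pbw_column n c" "length c \<in> D" using that cs by (auto simp: standard_columns_def)
    with D show "1 \<le> length c" "length c \<le> n - 1" by auto
  qed
  have dom: "sorted_wrt dominates cs" using cs by (auto simp: standard_columns_def)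
  then have srt: "sorted_wrt (\<lambda>c c'. length c' \<le> length c) cs"
    by (rule sorted_wrt_mono_rel[rotated]) (simp add: dominates_def)
  have lam: "lam \<in> dominant_weights D"
    using col(2) by (auto simp: dominant_weights_iff[OF fin] lam_def filter_empty_conv)
  have row: "row_length n lam i = length (filter (\<lambda>c. i \<le> length c) cs)" for i
  proof -
    have "row_length n lam i = length (filter (\<lambda>c. length c \<in> {i..n - 1}) cs)"
      unfolding row_length_def lam_def by (rule sum_length_filter) simp
    also have "filter (\<lambda>c. length c \<in> {i..n - 1}) cs = filter (\<lambda>c. i \<le> length c) cs"
      by (rule filter_cong) (use col in auto)
    finally show ?thesis .
  qed
  have row1: "row_length n lam 1 = length cs"
    unfolding row by (subst filter_True) (use col in auto)
  have clen: "column_length n lam (Suc j) = length (cs ! j)" if j: "j < length cs" for j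
  proof -
    have "(i, Suc j) \<in> young_diagram n lam \<longleftrightarrow> i \<in> {1..length (cs ! j)}" for i
    proof -
      have "(i, Suc j) \<in> young_diagram n lam \<longleftrightarrow> 1 \<le> i \<and> i \<le> n - 1 \<and> j < row_length n lam i"
        by (auto simp: young_diagram_def)
      also have "j < row_length n lam i \<longleftrightarrow> i \<le> length (cs ! j)"
        unfolding row by (rule nth_filter_length_iff[OF srt j])
      finally show ?thesis using col(4)[OF nth_mem[OF j]] by auto
    qed
    then have "{i. (i, Suc j) \<in> young_diagram n lam} = {1..length (cs ! j)}" by blast
    then show ?thesis by (simp add: column_length_def)
  qed
  have boxD: "\<exists>i' j'. i = Suc i' \<and> j = Suc j' \<and> j' < length cs \<and> i' < length (cs ! j') \<and> T (i, j) = cs ! j' ! i'"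
    if b: "(i, j) \<in> young_diagram n lam" for i j
  proof -
    have ij: "1 \<le> i" "1 \<le> j" using b by (auto simp: young_diagram_def)
    have "j \<le> length cs"
      using b row_length_antimono[of 1 i n lam] row1 by (auto simp: young_diagram_def)
    then have "j - 1 < length cs" using ij by simp
    moreover from this have "i \<le> length (cs ! (j - 1))"
      using b clen[of "j - 1"] ij by (simp add: mem_young_diagram_iff)
    ultimately show ?thesis using ij b
      by (intro exI[of _ "i - 1"] exI[of _ "j - 1"]) (auto simp: T_def)
  qed
  have boxI: "(Suc i, Suc j) \<in> young_diagram n lam" if "j < length cs" "i < length (cs ! j)" for i j
    using that clen by (simp add: mem_young_diagram_iff)
  have Tn: "T (Suc i, Suc j) = cs ! j ! i" if "j < length cs" "i < length (cs ! j)" for i j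
    using boxI[OF that] by (simp add: T_def)
  have "T \<in> pbw_tableaux n lam"
    unfolding pbw_tableaux_def
  proof (intro CollectI conjI)
    show "T \<in> young_diagram n lam \<rightarrow>\<^sub>E {1..n}"
    proof (rule PiE_I)
      fix x assume "x \<in> young_diagram n lam"
      then obtain i j where "j < length cs" "i < length (cs ! j)" "T x = cs ! j ! i"
        using boxD by (cases x) blast
      moreover from this have "cs ! j ! i \<in> {1..n}" using col(1)[of "cs ! j"]
        unfolding pbw_column_def by (meson nth_mem subsetD)
      ultimately show "T x \<in> {1..n}" by simp
    qed (auto simp: T_def)
    show "\<forall>(i, j)\<in>young_diagram n lam. T (i, j) \<le> column_length n lam j \<longrightarrow> T (i, j) = i"
    proof (clarify)
      fix i j assume "(i, j) \<in> young_diagram n lam" and le: "T (i, j) \<le> column_length n lam j"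
      then obtain i' j' where *: "i = Suc i'" "j = Suc j'" "j' < length cs" "i' < length (cs ! j')"
        "T (i, j) = cs ! j' ! i'" using boxD by blast
      with le col(1)[of "cs ! j'"] show "T (i, j) = i" by (simp add: clen pbw_column_def)
    qed
    show "\<forall>i1 i2 j. (i1, j) \<in> young_diagram n lam \<and> (i2, j) \<in> young_diagram n lam \<and> i1 < i2 \<and>
        T (i1, j) \<noteq> i1 \<longrightarrow> T (i2, j) < T (i1, j)"
    proof (clarify)
      fix i1 i2 j
      assume b: "(i1, j) \<in> young_diagram n lam" "(i2, j) \<in> young_diagram n lam"
        and a: "i1 < i2" "T (i1, j) \<noteq> i1"
      obtain i1' j' where *: "i1 = Suc i1'" "j = Suc j'" "j' < length cs" "i1' < length (cs ! j')"
        "T (i1, j) = cs ! j' ! i1'"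
        using boxD[OF b(1)] by blast
      obtain i2' where "i2 = Suc i2'" "i2' < length (cs ! j')" "T (i2, j) = cs ! j' ! i2'"
        using boxD[OF b(2)] *(2) by auto
      note * = * this
      have "pbw_column n (cs ! j')" using col(1) *(3) by simp
      moreover have "i1' < i2'" "cs ! j' ! i1' \<noteq> Suc i1'" using a * by simp_all
      ultimately have "cs ! j' ! i1' > cs ! j' ! i2'" using *(7) by (simp add: pbw_column_def)
      then show "T (i2, j) < T (i1, j)" using * by simp
    qed
  qed
  moreover have "\<exists>i1\<ge>i. (i1, j - 1) \<in> young_diagram n lam \<and> T (i1, j - 1) \<ge> T (i, j)"
    if b: "(i, j) \<in> young_diagram n lam" and j1: "1 < j" for i j
  proof -
    obtain i' j0 where 0: "i = Suc i'" "j = Suc j0" "j0 < length cs"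
      "i' < length (cs ! j0)" "T (i, j) = cs ! j0 ! i'"
      using boxD[OF b] by blast
    with j1 obtain j' where "j0 = Suc j'" by (cases j0) auto
    with 0 have *: "i = Suc i'" "j = Suc (Suc j')" "Suc j' < length cs"
      "i' < length (cs ! Suc j')" "T (i, j) = cs ! Suc j' ! i'" by simp_all
    then have "dominates (cs ! j') (cs ! Suc j')" using dom by (simp add: sorted_wrt_iff_nth_less)
    with * obtain i1 where "i' \<le> i1" "i1 < length (cs ! j')" "cs ! Suc j' ! i' \<le> cs ! j' ! i1"
      by (auto simp: dominates_def)
    with * show ?thesis by (intro exI[of _ "Suc i1"]) (auto simp: boxI Tn)
  qed
  ultimately have "T \<in> semistandard_pbw_tableaux n lam"
    unfolding semistandard_pbw_tableaux_def by blast
  moreover have "tableau_columns n lam T = cs"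
  proof (rule nth_equalityI)
    fix j assume "j < length (tableau_columns n lam T)"
    then have jr: "j < row_length n lam 1" by simp
    then have j: "j < length cs" by (simp only: row1)
    have len: "length (tableau_columns n lam T ! j) = length (cs ! j)"
      using length_nth_tableau_columns[OF jr] clen[OF j] by simp
    show "tableau_columns n lam T ! j = cs ! j"
    proof (rule nth_equalityI[OF len])
      fix i assume "i < length (tableau_columns n lam T ! j)"
      then have "i < length (cs ! j)" by (simp add: len)
      then show "tableau_columns n lam T ! j ! i = cs ! j ! i"
        using tableau_columns_nth_nth[OF jr] clen[OF j] Tn[OF j] by simp
    qed
  qed (use row1 in simp)
  ultimately show ?thesis using lam by blast
qed

section \<open>Evaluation at minors\<close>

lemma poly_mapping_sum_singles: "f = (\<Sum>m\<in>Poly_Mapping.keys f. Poly_Mapping.single m (Poly_Mapping.lookup f m))"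
proof (rule poly_mapping_eqI)
  fix k
  have "(\<Sum>m\<in>Poly_Mapping.keys f. Poly_Mapping.lookup (Poly_Mapping.single m (Poly_Mapping.lookup f m)) k) =
      (\<Sum>m\<in>Poly_Mapping.keys f. if m = k then Poly_Mapping.lookup f m else 0)"
    by (intro sum.cong) (auto simp: lookup_single when_def)
  then show "Poly_Mapping.lookup f k = Poly_Mapping.lookup (\<Sum>m\<in>Poly_Mapping.keys f. Poly_Mapping.single m (Poly_Mapping.lookup f m)) k"
    by (simp add: lookup_sum in_keys_iff)
qed

definition monomial_eval :: "('v \<Rightarrow> 'r::comm_ring_1) \<Rightarrow> ('v \<Rightarrow>\<^sub>0 nat) \<Rightarrow> 'r" where
  "monomial_eval x m = (\<Prod>v\<in>Poly_Mapping.keys m. x v ^ Poly_Mapping.lookup m v)"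

definition poly_subst :: "('v \<Rightarrow> 'm::comm_monoid_add \<Rightarrow>\<^sub>0 'c::comm_ring_1) \<Rightarrow>
    (('v \<Rightarrow>\<^sub>0 nat) \<Rightarrow>\<^sub>0 'c) \<Rightarrow> 'm \<Rightarrow>\<^sub>0 'c" where
  "poly_subst x f = (\<Sum>m\<in>Poly_Mapping.keys f. Poly_Mapping.single 0 (Poly_Mapping.lookup f m) * monomial_eval x m)"

lemma monomial_eval_superset:
  assumes "finite S" "Poly_Mapping.keys m \<subseteq> S"
  shows "monomial_eval x m = (\<Prod>v\<in>S. x v ^ Poly_Mapping.lookup m v)"
  unfolding monomial_eval_def
  by (rule prod.mono_neutral_left) (use assms in \<open>auto simp: in_keys_iff\<close>)

lemma monomial_eval_add: "monomial_eval x (a + b) = monomial_eval x a * monomial_eval x b"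
proof -
  have "Poly_Mapping.keys (a + b) \<subseteq> Poly_Mapping.keys a \<union> Poly_Mapping.keys b" by (rule keys_add)
  then show ?thesis
    by (simp add: monomial_eval_superset[of "Poly_Mapping.keys a \<union> Poly_Mapping.keys b"] lookup_add power_add prod.distrib)
qed

lemma monomial_eval_single [simp]: "monomial_eval x (Poly_Mapping.single v (Suc 0)) = x v"
  by (simp add: monomial_eval_def)

lemma monomial_eval_zero [simp]: "monomial_eval x 0 = 1"
  by (simp add: monomial_eval_def)

lemma poly_subst_superset:
  assumes "finite S" "Poly_Mapping.keys f \<subseteq> S"
  shows "poly_subst x f = (\<Sum>m\<in>S. Poly_Mapping.single 0 (Poly_Mapping.lookup f m) * monomial_eval x m)"
  unfolding poly_subst_def
  by (rule sum.mono_neutral_left) (use assms in \<open>auto simp: in_keys_iff\<close>)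

lemma poly_subst_add: "poly_subst x (f + g) = poly_subst x f + poly_subst x g"
proof -
  have "Poly_Mapping.keys (f + g) \<subseteq> Poly_Mapping.keys f \<union> Poly_Mapping.keys g" by (rule keys_add)
  then show ?thesis
    by (simp add: poly_subst_superset[of "Poly_Mapping.keys f \<union> Poly_Mapping.keys g"] lookup_add single_add distrib_right sum.distrib)
qed

lemma poly_subst_zero [simp]: "poly_subst x 0 = 0"
  by (simp add: poly_subst_def)

lemma poly_subst_uminus: "poly_subst x (- f) = - poly_subst x f"
proof -
  have "poly_subst x (- f) + poly_subst x f = 0"
    unfolding poly_subst_add[symmetric] by simp
  then show ?thesis by (simp add: eq_neg_iff_add_eq_0)
qed

lemma poly_subst_diff: "poly_subst x (f - g) = poly_subst x f - poly_subst x g"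
  using poly_subst_add[of x f "- g"] by (simp add: poly_subst_uminus)

lemma poly_subst_sum: "poly_subst x (sum f S) = (\<Sum>i\<in>S. poly_subst x (f i))"
  by (induction S rule: infinite_finite_induct) (simp_all add: poly_subst_add)

lemma poly_subst_single:
  "poly_subst x (Poly_Mapping.single m c) = Poly_Mapping.single 0 c * monomial_eval x m"
  by (simp add: poly_subst_def)

lemma poly_subst_one [simp]: "poly_subst x 1 = 1"
  using poly_subst_single[of x 0 1] by simp

lemma poly_subst_mult:
  fixes x :: "'v \<Rightarrow> 'm::comm_monoid_add \<Rightarrow>\<^sub>0 'c::comm_ring_1"
  shows "poly_subst x (f * g) = poly_subst x f * poly_subst x g"
proof -
  let ?F = "\<lambda>m. Poly_Mapping.single m (Poly_Mapping.lookup f m)" and ?G = "\<lambda>m. Poly_Mapping.single m (Poly_Mapping.lookup g m)"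
  have "poly_subst x (?F a * ?G b) = poly_subst x (?F a) * poly_subst x (?G b)" for a b
  proof -
    have single: "Poly_Mapping.single (0::'m) (Poly_Mapping.lookup f a * Poly_Mapping.lookup g b) =
        Poly_Mapping.single 0 (Poly_Mapping.lookup f a) * Poly_Mapping.single 0 (Poly_Mapping.lookup g b)"
      by (simp add: mult_single)
    have "poly_subst x (?F a * ?G b) = Poly_Mapping.single 0 (Poly_Mapping.lookup f a * Poly_Mapping.lookup g b)
        * (monomial_eval x a * monomial_eval x b)"
      by (simp add: mult_single poly_subst_single monomial_eval_add)
    then show ?thesis
      by (simp only: single poly_subst_single ac_simps)
  qed
  then have "poly_subst x (sum ?F (Poly_Mapping.keys f) * sum ?G (Poly_Mapping.keys g)) =
      poly_subst x (sum ?F (Poly_Mapping.keys f)) * poly_subst x (sum ?G (Poly_Mapping.keys g))"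
    by (simp add: sum_product poly_subst_sum)
  then show ?thesis by (simp flip: poly_mapping_sum_singles)
qed

lemma poly_subst_prod_list: "poly_subst x (prod_list fs) = prod_list (map (poly_subst x) fs)"
  by (induction fs) (simp_all add: poly_subst_mult)

text \<open>\<open>W\<close> need not separate monomials; only its minimum must be attained once.
  Subtracting the term lets one condition cover the coefficient too: a coefficient other than 1
  would leave \<open>m\<close> among the keys, and \<open>m\<close> is not heavier than
  itself.\<close>

definition has_leading :: "('m \<Rightarrow> nat) \<Rightarrow> ('m \<Rightarrow>\<^sub>0 'c::comm_ring_1) \<Rightarrow> 'm \<Rightarrow> bool" where
  "has_leading W f m \<longleftrightarrow> (\<forall>k\<in>Poly_Mapping.keys (f - Poly_Mapping.single m 1). W m < W k)"

lemma has_leading_lookup: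
  assumes "has_leading W f m"
  shows "Poly_Mapping.lookup f m = 1"
proof -
  have "m \<notin> Poly_Mapping.keys (f - Poly_Mapping.single m 1)" using assms by (auto simp: has_leading_def)
  then show ?thesis by (simp add: in_keys_iff lookup_minus)
qed

lemma has_leading_keys:
  assumes "has_leading W f m" "k \<in> Poly_Mapping.keys f" "k \<noteq> m"
  shows "W m < W k"
  using assms by (auto simp: has_leading_def in_keys_iff lookup_minus lookup_single)

lemma has_leading_single: "has_leading W (Poly_Mapping.single m 1) m"
  by (simp add: has_leading_def)

text \<open>With \<open>m\<close> and \<open>m'\<close> also denoting the terms,
  \<open>f g - m m' = m (g - m') + (f - m) g\<close>. Each monomial on the right takes a strictly
  heavier factor from one side and none lighter than the leading one from the other.\<close>

lemma has_leading_mult: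
  fixes f g :: "'m::comm_monoid_add \<Rightarrow>\<^sub>0 'c::comm_ring_1"
  assumes W: "\<And>a b. W (a + b) = W a + W b"
    and f: "has_leading W f m" and g: "has_leading W g m'"
  shows "has_leading W (f * g) (m + m')"
  unfolding has_leading_def
proof
  let ?f = "f - Poly_Mapping.single m 1" and ?g = "g - Poly_Mapping.single m' 1"
  have eq: "f * g - Poly_Mapping.single (m + m') 1 = Poly_Mapping.single m 1 * ?g + ?f * g"
    by (simp add: algebra_simps mult_single)
  fix k assume "k \<in> Poly_Mapping.keys (f * g - Poly_Mapping.single (m + m') 1)"
  then have "k \<in> Poly_Mapping.keys (Poly_Mapping.single m 1 * ?g) \<union> Poly_Mapping.keys (?f * g)"
    unfolding eq by (rule subsetD[OF keys_add])
  then consider b where "k = m + b" "b \<in> Poly_Mapping.keys ?g"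
    | a b where "k = a + b" "a \<in> Poly_Mapping.keys ?f" "b \<in> Poly_Mapping.keys g"
  proof (elim UnE)
    assume k: "k \<in> Poly_Mapping.keys (Poly_Mapping.single m 1 * ?g)"
    obtain a b where "k = a + b" "a \<in> Poly_Mapping.keys (Poly_Mapping.single m (1::'c))"
      "b \<in> Poly_Mapping.keys ?g"
      using subsetD[OF keys_mult k] by blast
    then show ?thesis using that(1) by (auto split: if_splits)
  next
    assume k: "k \<in> Poly_Mapping.keys (?f * g)"
    show ?thesis using subsetD[OF keys_mult k] that(2) by blast
  qed
  then show "W (m + m') < W k"
  proof cases
    case 1
    then show ?thesis using g by (simp add: W has_leading_def)
  next
    case 2
    then have "W m < W a" using f by (simp add: has_leading_def)
    moreover have "W m' \<le> W b" using has_leading_keys[OF g 2(3)] by (cases "b = m'") auto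
    ultimately show ?thesis by (simp add: W 2)
  qed
qed

lemma has_leading_prod_list:
  fixes F :: "'a \<Rightarrow> 'm::comm_monoid_add \<Rightarrow>\<^sub>0 'c::comm_ring_1"
  assumes W: "\<And>a b. W (a + b) = W a + W b"
    and "\<And>c. c \<in> set cs \<Longrightarrow> has_leading W (F c) (l c)"
  shows "has_leading W (prod_list (map F cs)) (sum_list (map l cs))"
  using assms(2)
proof (induction cs)
  case Nil
  show ?case using has_leading_single[of W 0] by simp
qed (simp add: has_leading_mult[OF W])

text \<open>Among the elements with nonzero coefficient take one whose leading monomial is lightest.
  No other such element contains this monomial: it is not the leading one there, by injectivity, and
  it is not heavier than that one. The coefficient at this monomial thus isolates a single
  summand.\<close>

lemma independent_of_leading:
  fixes F :: "'a \<Rightarrow> 'm \<Rightarrow>\<^sub>0 'c::comm_ring_1"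
  assumes fin: "finite S" and inj: "inj_on l S"
    and lead: "\<And>s. s \<in> S \<Longrightarrow> has_leading W (F s) (l s)"
    and zero: "\<And>m. (\<Sum>s\<in>S. a s * Poly_Mapping.lookup (F s) m) = 0"
  shows "\<forall>s\<in>S. a s = 0"
proof (rule ccontr)
  assume "\<not> ?thesis"
  then obtain s where s: "s \<in> S" "a s \<noteq> 0" and min: "\<And>s'. s' \<in> S \<Longrightarrow> a s' \<noteq> 0 \<Longrightarrow> W (l s) \<le> W (l s')"
    using arg_min_if_finite[of "{s \<in> S. a s \<noteq> 0}" "W \<circ> l"] fin
      arg_min_least[of "{s \<in> S. a s \<noteq> 0}" _ "W \<circ> l"] by (auto simp del: arg_min_least)
  have "a s' * Poly_Mapping.lookup (F s') (l s) = 0" if s': "s' \<in> S" "s' \<noteq> s" for s'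
  proof (cases "a s' = 0")
    case False
    have "l s \<noteq> l s'" using inj s' s(1) by (auto dest: inj_onD)
    then have "l s \<notin> Poly_Mapping.keys (F s')"
      using has_leading_keys[OF lead[OF s'(1)], of "l s"] min[OF s'(1) False] by auto
    then show ?thesis by (simp add: in_keys_iff)
  qed simp
  then have "(\<Sum>s'\<in>S. a s' * Poly_Mapping.lookup (F s') (l s)) = a s * Poly_Mapping.lookup (F s) (l s)"
    using fin s(1) by (subst sum.remove[of S s]) auto
  then show False using zero[of "l s"] has_leading_lookup[OF lead[OF s(1)]] s(2) by simp
qed

section \<open>Minors of the generic matrix and the vanishing of the relations\<close>

type_synonym coordinate_poly = "(nat \<times> nat \<Rightarrow>\<^sub>0 nat) \<Rightarrow>\<^sub>0 complex"

text \<open>Column indices count from 0, but rows of the matrix from 1. The pairs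
  \<open>(0, d)\<close> are therefore free and serve as the variables
  \<open>t\<^sub>d\<close>.\<close>

definition coordinate :: "nat \<Rightarrow> nat \<Rightarrow> coordinate_poly" where
  "coordinate x i = Poly_Mapping.single (Poly_Mapping.single (x, i) 1) 1"

definition plucker_row :: "nat \<Rightarrow> nat \<Rightarrow> nat \<Rightarrow> coordinate_poly" where
  "plucker_row d x i = (if x \<le> d then (if x = Suc i then 1 else 0) else coordinate x i)"

definition plucker_minor :: "nat list \<Rightarrow> coordinate_poly" where
  "plucker_minor L = coordinate 0 (length L) * rows_det (length L) (\<lambda>i. plucker_row (length L) (L ! i))"

definition plucker_eval :: "plucker_poly \<Rightarrow> coordinate_poly" where
  "plucker_eval = poly_subst (\<lambda>A. plucker_minor (sorted_list_of_set A))"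

lemma plucker_minor_swap:
  assumes "Suc i < length L"
  shows "plucker_minor (L[i := L ! Suc i, Suc i := L ! i]) = - plucker_minor L"
proof -
  let ?f = "\<lambda>a. plucker_row (length L) (L ! a)"
  have "rows_det (length L) (\<lambda>a. plucker_row (length L) (L[i := L ! Suc i, Suc i := L ! i] ! a)) =
      rows_det (length L) (?f(i := ?f (Suc i), Suc i := ?f i))"
    by (rule rows_det_cong) (use assms in \<open>auto simp: nth_list_update\<close>)
  also have "\<dots> = - rows_det (length L) ?f"
    by (rule rows_det_swap) (use assms in auto)
  finally show ?thesis by (simp add: plucker_minor_def)
qed

text \<open>Both sides change sign under a swap of neighbours, which reduces the claim for distinct
  indices to increasing sequences. These have no inversions, and there the minor is the value
  substituted for the variable. A repeated index makes both sides 0.\<close>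

lemma plucker_eval_var: "plucker_eval (plucker_var L) = plucker_minor L"
proof (cases "distinct L")
  case True
  then show ?thesis
  proof (induction L rule: adjacent_sort_induct)
    case (swap L i)
    then show ?case
      by (simp add: plucker_var_adjacent_swap plucker_minor_swap plucker_eval_def poly_subst_uminus)
  next
    case sorted
    let ?L = "sorted_list_of_set (set L)"
    have "?L ! a \<le> ?L ! b" if "a < b" "b < length ?L" for a b
      using that by (intro sorted_nth_mono) auto
    then have "inversions ?L = {}"
      unfolding inversions_def by (metis (no_types, lifting) Collect_empty_eq case_prodE leD)
    then show ?case
      by (simp add: plucker_var_def plucker_eval_def poly_subst_single)
  qed
next
  case False
  then obtain a b where ab: "a < length L" "b < length L" "a \<noteq> b" "L ! a = L ! b"
    by (auto simp: distinct_conv_nth)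
  have "rows_det (length L) (\<lambda>i. plucker_row (length L) (L ! i)) = 0"
    by (rule rows_det_eq_rows[OF ab(1-3)]) (simp add: ab(4))
  with False show ?thesis by (simp add: plucker_minor_def plucker_var_def plucker_eval_def)
qed

lemma exchange_left_nth:
  assumes "set r \<subseteq> {..<length L}" "a < length L"
  shows "exchange_left r L J ! a = replace_rows r ((!) L) ((!) J) a"
  using assms(1)
proof (induction r rule: rev_induct)
  case (snoc x r)
  have "fold (\<lambda>i M. M[(r @ [x]) ! i := J ! i]) [0..<length r] L =
      fold (\<lambda>i M. M[r ! i := J ! i]) [0..<length r] L"
    by (rule List.fold_cong) (auto simp: nth_append)
  then have "exchange_left (r @ [x]) L J = (exchange_left r L J)[x := J ! length r]"
    by (simp add: exchange_left_def)
  with snoc assms(2) show ?case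
    by (auto simp: replace_rows_snoc nth_list_update exchange_left_facts(1))
qed (simp add: exchange_left_def replace_rows_def)

text \<open>Together with \<open>plucker_row_killed\<close> this compares row \<open>x\<close> in
  the two sizes. For \<open>x \<le> q\<close> it is a unit vector in both and for
  \<open>x > p\<close> generic in both; in between it is generic in size \<open>q\<close> but, in
  size \<open>p\<close>, a unit vector whose 1 lies beyond the first \<open>q\<close>
  columns.\<close>

lemma plucker_row_restrict:
  assumes "x \<notin> {q + 1..p}" "q \<le> p" "j < q"
  shows "plucker_row p x j = plucker_row q x j"
  using assms by (auto simp: plucker_row_def)

lemma plucker_row_killed:
  assumes "x \<in> {q + 1..p}" "j < q"
  shows "plucker_row p x j = 0"
  using assms by (auto simp: plucker_row_def)

lemma fact_mult_cancel_poly: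
  fixes f g :: "'m::comm_monoid_add \<Rightarrow>\<^sub>0 'c::field_char_0"
  assumes "fact k * f = fact k * g"
  shows "f = g"
proof -
  have "Poly_Mapping.single 0 (inverse (fact k)) * (fact k :: 'm \<Rightarrow>\<^sub>0 'c) = 1"
  proof -
    have "(fact k :: 'm \<Rightarrow>\<^sub>0 'c) = Poly_Mapping.single 0 (of_nat (fact k))"
      by (metis of_nat_fact single_of_nat)
    then show ?thesis by (simp add: mult_single)
  qed
  with assms show ?thesis by (metis mult.assoc mult_1)
qed

text \<open>A row with number in \<open>{q + 1..p}\<close> makes a determinant of size
  \<open>q\<close> vanish when it enters in its version of size \<open>p\<close>. This accounts both
  for the summands omitted from the relation and for the factor \<epsilon>, so the full exchange
  identity yields exactly the degenerate relation.\<close>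

lemma plucker_eval_relation:
  assumes q: "length J \<le> length L" and k: "k \<le> length J"
  shows "plucker_eval (degenerate_plucker_relation k L J) = 0"
proof -
  define p q where "p = length L" and "q = length J"
  have pq: "q \<le> p" "k \<le> q" using assms by (simp_all add: p_def q_def)
  let ?v = "\<lambda>a. plucker_row p (L ! a)"
  \<comment> \<open>The first \<open>k\<close> rows travel into the determinant of size
    \<open>p\<close> and must already be rows of that size; the others stay behind and keep size
    \<open>q\<close>.\<close>
  let ?w = "\<lambda>i. if i < k then plucker_row p (J ! i) else plucker_row q (J ! i)"
  let ?S = "{r. length r = k \<and> sorted_wrt (<) r \<and> set r \<subseteq> {..<p}}"
  let ?ok = "\<lambda>r. (\<lambda>a. L ! a) ` set r \<inter> {q + 1..p} = {}"
  let ?t = "coordinate 0 p * coordinate 0 q"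
  let ?F = "\<lambda>r. rows_det p (replace_rows r ?v ?w) * rows_det q (\<lambda>i. if i < k then ?v (r ! i) else ?w i)"
  let ?e = "if set (take k J) \<inter> {q + 1..p} = {} then 1 else 0"
  have "finite ?S"
    by (rule finite_subset[OF _ finite_position_lists[of k p]])
      (auto simp: position_lists_def strict_sorted_iff)
  \<comment> \<open>Stated for any numbers \<open>f i\<close> in the first \<open>k\<close> rows
    because it serves twice: for \<open>J\<close> itself, where it gives \<epsilon>, and for the
    entries of \<open>L\<close> that are moved over.\<close>
  have right: "rows_det q (\<lambda>i. if i < k then plucker_row p (f i) else plucker_row q (J ! i)) =
      (if f ` {..<k} \<inter> {q + 1..p} = {}
       then rows_det q (\<lambda>i. if i < k then plucker_row q (f i) else plucker_row q (J ! i)) else 0)" for f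
  proof (cases "f ` {..<k} \<inter> {q + 1..p} = {}")
    case True
    then have "rows_det q (\<lambda>i. if i < k then plucker_row p (f i) else plucker_row q (J ! i)) =
        rows_det q (\<lambda>i. if i < k then plucker_row q (f i) else plucker_row q (J ! i))"
    proof (intro rows_det_cong)
      fix i j assume "j < q"
      have "f i \<notin> {q + 1..p}" if "i < k" using True that by blast
      then show "(if i < k then plucker_row p (f i) else plucker_row q (J ! i)) j =
          (if i < k then plucker_row q (f i) else plucker_row q (J ! i)) j"
        using plucker_row_restrict[OF _ pq(1) \<open>j < q\<close>, of "f i"] by simp
    qed
    with True show ?thesis by simp
  next
    case False
    then have "\<exists>i<k. f i \<in> {q + 1..p}" by blast
    then obtain i where "i < k" "f i \<in> {q + 1..p}" by blast
    then have "rows_det q (\<lambda>i. if i < k then plucker_row p (f i) else plucker_row q (J ! i)) = 0"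
      using pq plucker_row_killed[of "f i" q p]
      by (intro rows_det_zero_row[of i]) (simp_all del: atLeastAtMost_iff)
    with False show ?thesis by (simp only: if_False)
  qed
  have J: "rows_det q ?w = ?e * rows_det q (\<lambda>i. plucker_row q (J ! i))"
  proof -
    have "(!) J ` {..<k} = set (take k J)"
      using pq nth_image[of k J] by (simp add: q_def atLeast0LessThan)
    moreover have "rows_det q (\<lambda>i. if i < k then plucker_row q (J ! i) else plucker_row q (J ! i)) =
        rows_det q (\<lambda>i. plucker_row q (J ! i))" by simp
    ultimately show ?thesis by (simp only: right) simp
  qed
  have F: "plucker_eval (plucker_var (exchange_left r L J) * plucker_var (exchange_right r L J)) = ?t * ?F r"
    if r: "r \<in> ?S" "?ok r" for r
  proof -
    have dist: "distinct r" "set r \<subseteq> {..<length L}" and len: "length r = k"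
      using r by (auto simp: strict_sorted_iff p_def)
    have "rows_det p (\<lambda>a. plucker_row p (exchange_left r L J ! a)) = rows_det p (replace_rows r ?v ?w)"
    proof (rule rows_det_cong)
      fix a j assume "a < p"
      have "plucker_row p (replace_rows r ((!) L) ((!) J) a) = replace_rows r ?v ?w a"
        using dist(1) len by (cases "a \<in> set r") (auto simp: replace_rows_notin replace_rows_nth in_set_conv_nth)
      then show "plucker_row p (exchange_left r L J ! a) j = replace_rows r ?v ?w a j"
        using \<open>a < p\<close> dist(2) by (simp add: exchange_left_nth p_def)
    qed
    moreover have "rows_det q (\<lambda>a. plucker_row q (exchange_right r L J ! a)) =
        rows_det q (\<lambda>i. if i < k then ?v (r ! i) else ?w i)"
    proof -
      have "(\<lambda>i. L ! (r ! i)) ` {..<k} = (\<lambda>a. L ! a) ` set r"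
      proof -
        have "set r = (!) r ` {..<k}" using nth_image[of k r] len by (simp add: atLeast0LessThan)
        then show ?thesis by (simp only: image_image)
      qed
      with r(2) have "rows_det q (\<lambda>i. if i < k then ?v (r ! i) else plucker_row q (J ! i)) =
          rows_det q (\<lambda>i. if i < k then plucker_row q (L ! (r ! i)) else plucker_row q (J ! i))"
        using right[of "\<lambda>i. L ! (r ! i)"] by simp
      moreover have "(\<lambda>i. if i < k then ?v (r ! i) else ?w i) =
          (\<lambda>i. if i < k then ?v (r ! i) else plucker_row q (J ! i))" by auto
      moreover have "rows_det q (\<lambda>a. plucker_row q (exchange_right r L J ! a)) =
          rows_det q (\<lambda>i. if i < k then plucker_row q (L ! (r ! i)) else plucker_row q (J ! i))"
        by (rule rows_det_cong) (use len pq in \<open>auto simp: exchange_right_def nth_append q_def\<close>)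
      ultimately show ?thesis by simp
    qed
    moreover have "length (exchange_right r L J) = q"
      using len pq by (simp add: exchange_right_def q_def)
    ultimately show ?thesis
      using plucker_eval_var unfolding plucker_eval_def
      by (simp add: poly_subst_mult plucker_minor_def exchange_left_facts(1) flip: p_def)
  qed
  have "(\<Sum>r\<in>{r \<in> ?S. ?ok r}. ?F r) = sum ?F ?S"
  proof (rule sum.mono_neutral_left)
    show "\<forall>r\<in>?S - {r \<in> ?S. ?ok r}. ?F r = 0"
    proof
      fix r assume r: "r \<in> ?S - {r \<in> ?S. ?ok r}"
      then have "\<exists>a\<in>set r. L ! a \<in> {q + 1..p}" by blast
      then obtain a where a: "a \<in> set r" "L ! a \<in> {q + 1..p}" by (rule bexE)
      moreover have len: "length r = k" using r by blast
      ultimately obtain i where i: "i < k" "r ! i = a" using in_set_conv_nth[of a r] by blast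
      with a(2) have i: "i < k" "L ! (r ! i) \<in> {q + 1..p}" by simp_all
      then have "rows_det q (\<lambda>i. if i < k then ?v (r ! i) else ?w i) = 0"
        using pq plucker_row_killed[of "L ! (r ! i)" q p]
        by (intro rows_det_zero_row[of i]) (simp_all del: atLeastAtMost_iff)
      then show "?F r = 0" by simp
    qed
  qed (use \<open>finite ?S\<close> in auto)
  also have "sum ?F ?S = rows_det p ?v * rows_det q ?w"
    by (rule fact_mult_cancel_poly[of k]) (rule exchange_rows[OF pq(2,1)])
  finally have main: "(\<Sum>r\<in>{r \<in> ?S. ?ok r}. ?F r) = rows_det p ?v * rows_det q ?w" .
  have "plucker_eval (\<Sum>r | length r = k \<and> sorted_wrt (<) r \<and> set r \<subseteq> {..<p} \<and> ?ok r.
      plucker_var (exchange_left r L J) * plucker_var (exchange_right r L J)) =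
      (\<Sum>r\<in>{r \<in> ?S. ?ok r}. ?t * ?F r)"
    unfolding plucker_eval_def poly_subst_sum
    by (rule sum.cong) (use F in \<open>auto simp: plucker_eval_def\<close>)
  also have "\<dots> = ?t * (rows_det p ?v * rows_det q ?w)"
    by (simp only: main sum_distrib_left[symmetric])
  finally have sum: "plucker_eval (\<Sum>r | length r = k \<and> sorted_wrt (<) r \<and> set r \<subseteq> {..<p} \<and> ?ok r.
      plucker_var (exchange_left r L J) * plucker_var (exchange_right r L J)) =
      ?t * (rows_det p ?v * rows_det q ?w)" .
  have "plucker_eval (?e * plucker_var L * plucker_var J) = ?e * plucker_minor L * plucker_minor J"
    using plucker_eval_var unfolding plucker_eval_def by (simp add: poly_subst_mult)
  also have "\<dots> = ?t * (rows_det p ?v * rows_det q ?w)"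
    unfolding J by (simp add: plucker_minor_def p_def q_def)
  finally show ?thesis
    using sum unfolding degenerate_plucker_relation_def Let_def p_def q_def plucker_eval_def
    by (simp only: poly_subst_diff diff_self)
qed

section \<open>Leading terms\<close>

text \<open>The column index acts as a digit in base \<open>n + 1\<close> at the place given by the
  row number. In a PBW column an entry above its row number exceeds all entries below it, so among
  such rows the topmost is the most significant.\<close>

definition coordinate_weight :: "nat \<Rightarrow> (nat \<times> nat \<Rightarrow>\<^sub>0 nat) \<Rightarrow> nat" where
  "coordinate_weight n m = (\<Sum>v\<in>{..n} \<times> {..n}. Poly_Mapping.lookup m v * (snd v * Suc n ^ fst v))"

text \<open>The diagonal product of the minor. An entry of at most \<open>length c\<close> equals
  its row number, so its unit vector contributes 1 on the diagonal.\<close>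

definition leading_monomial :: "nat list \<Rightarrow> nat \<times> nat \<Rightarrow>\<^sub>0 nat" where
  "leading_monomial c = Poly_Mapping.single (0, length c) 1 +
    (\<Sum>i<length c. if length c < c ! i then Poly_Mapping.single (c ! i, i) 1 else 0)"

lemma coordinate_weight_add: "coordinate_weight n (a + b) = coordinate_weight n a + coordinate_weight n b"
  by (simp add: coordinate_weight_def lookup_add distrib_right sum.distrib)

lemma coordinate_weight_zero [simp]: "coordinate_weight n 0 = 0"
  by (simp add: coordinate_weight_def)

lemma coordinate_weight_sum: "coordinate_weight n (sum f S) = (\<Sum>i\<in>S. coordinate_weight n (f i))"
  by (induction S rule: infinite_finite_induct) (simp_all add: coordinate_weight_add)

lemma coordinate_weight_single:
  assumes "x \<le> n" "i \<le> n"
  shows "coordinate_weight n (Poly_Mapping.single (x, i) 1) = i * Suc n ^ x"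
proof -
  have "coordinate_weight n (Poly_Mapping.single (x, i) 1) =
      (\<Sum>v\<in>{..n} \<times> {..n}. if v = (x, i) then snd v * Suc n ^ fst v else 0)"
    unfolding coordinate_weight_def by (intro sum.cong) (auto simp: lookup_single when_def)
  then show ?thesis using assms by simp
qed

lemma geometric_sum_Suc: "n * (\<Sum>y<m. Suc n ^ y) + 1 = Suc n ^ m"
  by (induction m) (auto simp: algebra_simps)

text \<open>In base \<open>n + 1\<close> the first row moved by the permutation decides the comparison, because the later
  entries off the diagonal are smaller.\<close>

lemma identity_minimal_weight:
  assumes c: "pbw_column n c" and len: "length c \<le> n"
    and perm: "\<pi> permutes {0..<length c}" and ne: "\<pi> \<noteq> id"
    and fixed: "\<And>i. i < length c \<Longrightarrow> c ! i \<le> length c \<Longrightarrow> \<pi> i = i"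
  shows "(\<Sum>i<length c. if length c < c ! i then i * Suc n ^ (c ! i) else 0) <
    (\<Sum>i<length c. if length c < c ! i then \<pi> i * Suc n ^ (c ! i) else 0)"
proof -
  define p where "p = length c"
  define a where "a = (LEAST i. \<pi> i \<noteq> i)"
  let ?g = "\<lambda>\<sigma> i. if p < c ! i then \<sigma> i * Suc n ^ (c ! i) else (0::nat)"
  have ex: "\<exists>i. \<pi> i \<noteq> i" using ne by auto
  have a: "\<pi> a \<noteq> a" unfolding a_def by (rule LeastI_ex[OF ex])
  have below: "\<pi> i = i" if "i < a" for i using that not_less_Least unfolding a_def by blast
  have ap: "a < p" using a perm by (auto simp: permutes_def p_def)
  have "\<not> \<pi> a < a"
  proof
    assume "\<pi> a < a"
    then have "\<pi> (\<pi> a) = \<pi> a" by (rule below)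
    then show False using a permutes_inj[OF perm] by (simp add: inj_eq)
  qed
  then have up: "Suc a \<le> \<pi> a" using a by simp
  have ca: "p < c ! a" using fixed[of a] a ap by (force simp: p_def)
  have split: "sum (?g \<sigma>) {..<p} = sum (?g \<sigma>) {..<a} + (?g \<sigma> a + sum (?g \<sigma>) {Suc a..<p})" for \<sigma>
  proof -
    have "sum (?g \<sigma>) {..<p} = sum (?g \<sigma>) {..<a} + sum (?g \<sigma>) {a..<p}"
      unfolding lessThan_atLeast0 by (rule sum.atLeastLessThan_concat[symmetric]) (use ap in simp_all)
    then show ?thesis using ap by (simp add: sum.atLeast_Suc_lessThan)
  qed
  have "sum (?g id) {Suc a..<p} \<le> (\<Sum>i\<in>{Suc a..<p}. n * Suc n ^ (c ! i))"
    using len by (intro sum_mono) (auto simp: p_def)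
  also have "\<dots> = n * (\<Sum>i\<in>{Suc a..<p}. Suc n ^ (c ! i))"
    by (simp add: sum_distrib_left)
  also have "(\<Sum>i\<in>{Suc a..<p}. Suc n ^ (c ! i)) = (\<Sum>y\<in>(!) c ` {Suc a..<p}. Suc n ^ y)"
  proof (rule sum.reindex_cong[symmetric])
    show "inj_on ((!) c) {Suc a..<p}"
      using pbw_column_distinct[OF c] by (auto simp: inj_on_def p_def nth_eq_iff_index_eq)
  qed auto
  also have "\<dots> \<le> (\<Sum>y<c ! a. Suc n ^ y)"
  proof (rule sum_mono2)
    have "c ! a \<noteq> Suc a" using ca ap by simp
    then show "(!) c ` {Suc a..<p} \<subseteq> {..<c ! a}" using c by (auto simp: pbw_column_def p_def)
  qed auto
  finally have "sum (?g id) {Suc a..<p} \<le> n * (\<Sum>y<c ! a. Suc n ^ y)" by simp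
  \<comment> \<open>Below row \<open>a\<close>, the first row that \<pi> moves, the identity
    collects distinct powers below \<open>Suc n ^ (c ! a)\<close> with digits at most
    \<open>n\<close>. This is less than the one extra unit that \<pi> has in the digit of row
    \<open>a\<close>.\<close>
  then have tail: "sum (?g id) {Suc a..<p} < Suc n ^ (c ! a)"
    using geometric_sum_Suc[of n "c ! a"] by simp
  have "sum (?g id) {..<a} = sum (?g \<pi>) {..<a}"
    by (rule sum.cong) (simp_all add: below)
  moreover have "?g id a + Suc n ^ (c ! a) \<le> ?g \<pi> a"
    using ca mult_le_mono1[OF up, of "Suc n ^ (c ! a)"] by simp
  ultimately have "sum (?g id) {..<p} < sum (?g \<pi>) {..<p}"
    unfolding split using tail by linarith
  then show ?thesis by (simp only: p_def id_apply)
qed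

lemma prod_single_one:
  fixes m :: "'a \<Rightarrow> 'm::comm_monoid_add"
  shows "(\<Prod>i\<in>S. Poly_Mapping.single (m i) (1::'c::comm_ring_1)) = Poly_Mapping.single (sum m S) 1"
  by (induction S rule: infinite_finite_induct) (simp_all add: mult_single)

text \<open>In the Leibniz expansion a permutation that moves a unit row off its diagonal place
  gives 0. Every other one gives a signed monomial, the identity with coefficient 1, and all
  monomials besides that of the identity are strictly heavier, so their signs and cancellations are
  harmless.\<close>

lemma rows_det_leading:
  assumes c: "pbw_column n c" and len: "length c \<le> n"
  shows "has_leading (coordinate_weight n) (rows_det (length c) (\<lambda>i. plucker_row (length c) (c ! i)))
    (\<Sum>i<length c. if length c < c ! i then Poly_Mapping.single (c ! i, i) 1 else 0)"
proof -
  define p where "p = length c"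
  let ?P = "{\<pi>. \<pi> permutes {0..<p}}"
  define trm :: "(nat \<Rightarrow> nat) \<Rightarrow> coordinate_poly" where "trm \<pi> = signof \<pi> * (\<Prod>i = 0..<p. plucker_row p (c ! i) (\<pi> i))" for \<pi>
  define mono :: "(nat \<Rightarrow> nat) \<Rightarrow> nat \<times> nat \<Rightarrow>\<^sub>0 nat" where
    "mono \<pi> = (\<Sum>i<p. if p < c ! i then Poly_Mapping.single (c ! i, \<pi> i) (1::nat) else 0)" for \<pi>
  define good :: "(nat \<Rightarrow> nat) \<Rightarrow> bool" where "good \<pi> \<longleftrightarrow> (\<forall>i<p. c ! i \<le> p \<longrightarrow> \<pi> i = i)" for \<pi>
  have fin: "finite ?P" by (rule finite_permutations) simp
  have fixed: "c ! i = Suc i" if "i < p" "c ! i \<le> p" for i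
    using c that by (auto simp: pbw_column_def p_def)
  have cn: "c ! i \<le> n" if "i < p" for i
    using c that by (auto simp: pbw_column_def p_def dest!: nth_mem)
  have det: "rows_det p (\<lambda>i. plucker_row p (c ! i)) = sum trm ?P"
    unfolding rows_det_def trm_def
    by (subst det_def'[of _ p]) (auto intro!: sum.cong prod.cong simp: trm_def permutes_in_image)
  have prod: "(\<Prod>i = 0..<p. plucker_row p (c ! i) (\<pi> i)) =
      (if good \<pi> then Poly_Mapping.single (mono \<pi>) 1 else 0)" for \<pi>
  proof (cases "good \<pi>")
    case True
    have "(\<Prod>i = 0..<p. plucker_row p (c ! i) (\<pi> i)) =
        (\<Prod>i = 0..<p. Poly_Mapping.single (if p < c ! i then Poly_Mapping.single (c ! i, \<pi> i) 1 else 0) 1)"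
      using True fixed by (intro prod.cong) (auto simp: good_def plucker_row_def coordinate_def)
    with True show ?thesis by (simp add: prod_single_one mono_def atLeast0LessThan)
  next
    case False
    then obtain i where i: "i < p" "c ! i \<le> p" "\<pi> i \<noteq> i" by (auto simp: good_def)
    then have "plucker_row p (c ! i) (\<pi> i) = 0" using fixed[of i] by (simp add: plucker_row_def)
    with i(1) have "(\<Prod>i = 0..<p. plucker_row p (c ! i) (\<pi> i)) = 0"
      by (intro prod_zero) auto
    with False show ?thesis by simp
  qed
  have weight: "coordinate_weight n (mono \<pi>) = (\<Sum>i<p. if p < c ! i then \<pi> i * Suc n ^ (c ! i) else 0)"
    if "\<pi> permutes {0..<p}" for \<pi>
  proof -
    have "\<pi> i \<le> n" if "i < p" for i
      using permutes_in_image[OF \<open>\<pi> permutes {0..<p}\<close>, of i] that len by (simp add: p_def)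
    then show ?thesis
      unfolding mono_def coordinate_weight_sum using cn
      by (intro sum.cong) (auto simp: coordinate_weight_single[simplified])
  qed
  have "trm id = Poly_Mapping.single (mono id) 1"
    using prod[of id] by (simp add: trm_def good_def)
  then have "rows_det p (\<lambda>i. plucker_row p (c ! i)) - Poly_Mapping.single (mono id) 1 = sum trm (?P - {id})"
    unfolding det using fin by (subst sum.remove[of ?P id]) (auto simp: permutes_id)
  then have keys: "Poly_Mapping.keys (rows_det p (\<lambda>i. plucker_row p (c ! i)) - Poly_Mapping.single (mono id) 1)
      \<subseteq> (\<Union>\<pi>\<in>?P - {id}. Poly_Mapping.keys (trm \<pi>))"
    using keys_sum by metis
  have "coordinate_weight n (mono id) < coordinate_weight n k"
    if \<pi>: "\<pi> \<in> ?P - {id}" and k: "k \<in> Poly_Mapping.keys (trm \<pi>)" for \<pi> k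
  proof -
    have good: "good \<pi>" using k by (auto simp: trm_def prod split: if_splits)
    then have "trm \<pi> = signof \<pi> * Poly_Mapping.single (mono \<pi>) 1" by (simp add: trm_def prod)
    then have "k = mono \<pi>" using k by (auto simp: sign_def in_keys_iff lookup_single when_def split: if_splits)
    moreover have "coordinate_weight n (mono id) < coordinate_weight n (mono \<pi>)"
      using identity_minimal_weight[OF c len, of \<pi>] \<pi> good weight[of \<pi>] weight[OF permutes_id, unfolded id_apply]
      by (simp add: p_def good_def id_def)
    ultimately show ?thesis by simp
  qed
  then have "has_leading (coordinate_weight n) (rows_det p (\<lambda>i. plucker_row p (c ! i))) (mono id)"
    unfolding has_leading_def using keys by blast
  then show ?thesis unfolding mono_def p_def id_apply .
qed

lemma plucker_minor_leading:
  assumes "pbw_column n c" "length c \<le> n"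
  shows "has_leading (coordinate_weight n) (plucker_minor c) (leading_monomial c)"
  unfolding plucker_minor_def leading_monomial_def coordinate_def
  by (rule has_leading_mult[OF coordinate_weight_add has_leading_single rows_det_leading[OF assms]])

section \<open>Recovering the columns from the leading monomial\<close>

lemma lookup_leading_monomial_zero:
  "Poly_Mapping.lookup (leading_monomial c) (0, d) = (if d = length c then 1 else 0)"
proof -
  have "Poly_Mapping.lookup (\<Sum>i<length c. if length c < c ! i then Poly_Mapping.single (c ! i, i) (1::nat) else 0) (0, d) = 0"
    unfolding lookup_sum by (intro sum.neutral) (auto simp: lookup_single when_def)
  then show ?thesis by (auto simp: leading_monomial_def lookup_add lookup_single when_def)
qed

lemma lookup_leading_monomial_Suc:
  "Poly_Mapping.lookup (leading_monomial c) (Suc x, i) =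
    (if i < length c \<and> c ! i = Suc x \<and> length c < Suc x then 1 else 0)"
proof -
  have "Poly_Mapping.lookup (\<Sum>i<length c. if length c < c ! i then Poly_Mapping.single (c ! i, i) (1::nat) else 0) (Suc x, i) =
      (\<Sum>j<length c. if j = i then (if c ! i = Suc x \<and> length c < Suc x then 1 else 0) else 0)"
    unfolding lookup_sum by (intro sum.cong) (auto simp: lookup_single when_def)
  then show ?thesis by (auto simp: leading_monomial_def lookup_add lookup_single when_def)
qed

text \<open>Exponents are natural numbers, so nothing cancels: a variable occurs in the product as
  soon as one column contributes it.\<close>

lemma lookup_sum_list_leading_pos:
  "0 < Poly_Mapping.lookup (sum_list (map leading_monomial cs)) v \<longleftrightarrow>
    (\<exists>c\<in>set cs. 0 < Poly_Mapping.lookup (leading_monomial c) v)"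
  by (induction cs) (auto simp: lookup_add)

lemma dominates_refl: "dominates c c"
  by (auto simp: dominates_def)

text \<open>The entry \<open>c ! i\<close> occurs in row \<open>i\<close> of some column of the
  other list, so \<open>c'\<close> has an entry at least as large in a row
  \<open>i1 \<ge> i\<close>. That entry in turn occurs in the first list, so \<open>c\<close> has
  one at least as large in a row \<open>i2 \<ge> i1\<close>. All entries of \<open>c\<close> below
  \<open>c ! i\<close> are smaller than it, which forces \<open>i2 = i\<close> and equality
  throughout.\<close>

lemma leading_column_unique:
  assumes cs: "c # cs \<in> standard_columns n D" and cs': "c' # cs' \<in> standard_columns n D"
    and eq: "sum_list (map leading_monomial (c # cs)) = sum_list (map leading_monomial (c' # cs'))"
    and len: "length c = length c'" and i: "i < length c" "length c < c ! i"
  shows "c' ! i = c ! i"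
proof -
  have pbw: "pbw_column n c" "pbw_column n c'" using cs cs' by (auto simp: standard_columns_def)
  have dom: "dominates c x" if "x \<in> set (c # cs)" for x
    using cs that by (auto simp: standard_columns_def dominates_refl)
  have dom': "dominates c' x" if "x \<in> set (c' # cs')" for x
    using cs' that by (auto simp: standard_columns_def dominates_refl)
  obtain x where x: "c ! i = Suc x" using i by (cases "c ! i") auto
  have "0 < Poly_Mapping.lookup (sum_list (map leading_monomial (c # cs))) (Suc x, i)"
    unfolding lookup_sum_list_leading_pos using x i by (auto simp: lookup_leading_monomial_Suc)
  then obtain b where b: "b \<in> set (c' # cs')" "i < length b" "b ! i = Suc x"
    unfolding eq lookup_sum_list_leading_pos
    by (auto simp: lookup_leading_monomial_Suc split: if_splits)
  then obtain i1 where i1: "i \<le> i1" "i1 < length c'" "Suc x \<le> c' ! i1"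
    using dom'[OF b(1)] by (auto simp: dominates_def)
  obtain y where y: "c' ! i1 = Suc y" using i1 by (cases "c' ! i1") auto
  have "0 < Poly_Mapping.lookup (sum_list (map leading_monomial (c' # cs'))) (Suc y, i1)"
    unfolding lookup_sum_list_leading_pos using y i1 i x len by (auto simp: lookup_leading_monomial_Suc)
  then obtain b where b: "b \<in> set (c # cs)" "i1 < length b" "b ! i1 = Suc y"
    unfolding eq[symmetric] lookup_sum_list_leading_pos
    by (auto simp: lookup_leading_monomial_Suc split: if_splits)
  then obtain i2 where i2: "i1 \<le> i2" "i2 < length c" "Suc y \<le> c ! i2"
    using dom[OF b(1)] by (auto simp: dominates_def)
  have ne: "c ! i \<noteq> Suc i" using i by simp
  have "i2 = i"
  proof (rule ccontr)
    assume "i2 \<noteq> i"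
    then have "i < i2" using i1 i2 by simp
    then have "c ! i2 < c ! i" using pbw(1) ne i2 by (auto simp: pbw_column_def)
    then show False using x y i1 i2 by simp
  qed
  then show ?thesis using i1 i2 x y by simp
qed

text \<open>The first column is longest, so its length is the largest \<open>d\<close> for which
  \<open>t\<^sub>d\<close> occurs. Its entries above this length are settled by
  \<open>leading_column_unique\<close>, the others equal their row numbers. Its monomial then
  cancels, which leaves the remaining columns to the induction.\<close>

lemma leading_monomials_inj:
  assumes "cs \<in> standard_columns n D" "cs' \<in> standard_columns n D"
    and "sum_list (map leading_monomial cs) = sum_list (map leading_monomial cs')"
  shows "cs = cs'"
  using assms
proof (induction cs arbitrary: cs')
  case Nil
  show ?case
  proof (cases cs')
    case (Cons c cs1)
    have "0 < Poly_Mapping.lookup (sum_list (map leading_monomial cs')) (0, length c)"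
      unfolding lookup_sum_list_leading_pos Cons by (auto simp: lookup_leading_monomial_zero)
    with Nil.prems show ?thesis by simp
  qed simp
next
  case (Cons c cs)
  show ?case
  proof (cases cs')
    case Nil
    have "0 < Poly_Mapping.lookup (sum_list (map leading_monomial (c # cs))) (0, length c)"
      unfolding lookup_sum_list_leading_pos by (auto simp: lookup_leading_monomial_zero)
    with Nil Cons.prems show ?thesis by simp
  next
    case (Cons c' cs1)
    note prems = Cons.prems[unfolded Cons]
    have le: "length c \<le> length c'"
      if c: "c # cs \<in> standard_columns n D" and c': "c' # cs1 \<in> standard_columns n D"
        and eq: "sum_list (map leading_monomial (c # cs)) = sum_list (map leading_monomial (c' # cs1))"
      for c c' cs cs1
    proof -
      have "0 < Poly_Mapping.lookup (sum_list (map leading_monomial (c # cs))) (0, length c)"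
        unfolding lookup_sum_list_leading_pos by (auto simp: lookup_leading_monomial_zero)
      then have "\<exists>b\<in>set (c' # cs1). length b = length c"
        unfolding eq lookup_sum_list_leading_pos lookup_leading_monomial_zero
        by (metis less_numeral_extra(3))
      then obtain b where "b \<in> set (c' # cs1)" "length b = length c" by blast
      then show ?thesis using c' by (auto simp: standard_columns_def dominates_def)
    qed
    have len: "length c = length c'"
      using le[OF prems] le[OF prems(2,1) prems(3)[symmetric]] by simp
    have pbw: "pbw_column n c" "pbw_column n c'" using prems by (auto simp: standard_columns_def)
    have "c = c'"
    proof (rule nth_equalityI[OF len])
      fix i assume i: "i < length c"
      consider "length c < c ! i" | "length c < c' ! i" | "c ! i \<le> length c" "c' ! i \<le> length c" by linarith
      then show "c ! i = c' ! i"
      proof cases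
        case 1
        then show ?thesis using leading_column_unique[OF prems len i] by simp
      next
        case 2
        then show ?thesis
          using leading_column_unique[OF prems(2,1) prems(3)[symmetric] len[symmetric]] i len by simp
      next
        case 3
        then have "c ! i = Suc i" "c' ! i = Suc i" using pbw i len unfolding pbw_column_def by metis+
        then show ?thesis by simp
      qed
    qed
    moreover have "cs = cs1"
    proof (rule Cons.IH)
      show "cs \<in> standard_columns n D" "cs1 \<in> standard_columns n D"
        using prems by (auto simp: standard_columns_def)
      show "sum_list (map leading_monomial cs) = sum_list (map leading_monomial cs1)"
        using prems(3) \<open>c = c'\<close> by simp
    qed
    ultimately show ?thesis using Cons by simp
  qed
qed

lemma standard_columns_leading:
  assumes "D \<subseteq> {..n}" "cs \<in> standard_columns n D"
  shows "has_leading (coordinate_weight n) (plucker_eval (prod_list (map plucker_var cs)))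
    (sum_list (map leading_monomial cs))"
proof -
  have "map plucker_eval (map plucker_var cs) = map plucker_minor cs"
    by (simp add: plucker_eval_var)
  then have "plucker_eval (prod_list (map plucker_var cs)) = prod_list (map plucker_minor cs)"
    by (simp only: plucker_eval_def poly_subst_prod_list)
  moreover have "has_leading (coordinate_weight n) (prod_list (map plucker_minor cs))
      (sum_list (map leading_monomial cs))"
    using assms by (intro has_leading_prod_list coordinate_weight_add)
      (auto simp: standard_columns_def intro: plucker_minor_leading)
  ultimately show ?thesis by simp
qed

section \<open>Straightening\<close>

lemma antitone_bijection:
  fixes S T :: "nat set"
  assumes "finite S" "finite T" "card S = card T"
  shows "\<exists>f. bij_betw f S T \<and> (\<forall>x\<in>S. \<forall>y\<in>S. x < y \<longrightarrow> f y < f x)"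
proof -
  define m where "m = card S"
  obtain g where g: "bij_betw g {..<m} S" "strict_mono_on {..<m} g"
    using ex_bij_betw_strict_mono_card[OF assms(1)] m_def by metis
  obtain h where h: "bij_betw h {..<m} T" "strict_mono_on {..<m} h"
    using ex_bij_betw_strict_mono_card[OF assms(2)] m_def assms(3) by metis
  define g' where "g' = inv_into {..<m} g"
  have g': "bij_betw g' S {..<m}" unfolding g'_def by (rule bij_betw_inv_into[OF g(1)])
  have gg: "g (g' x) = x" if "x \<in> S" for x
    using that g(1) unfolding g'_def by (simp add: bij_betw_def f_inv_into_f)
  have g'm: "g' x < m" if "x \<in> S" for x using bij_betwE[OF g'] that by auto
  have r: "bij_betw (\<lambda>k. m - 1 - k) {..<m} {..<m}"
    by (rule bij_betw_byWitness[where f' = "\<lambda>k. m - 1 - k"]) auto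
  have "bij_betw (h \<circ> (\<lambda>k. m - 1 - k) \<circ> g') S T"
    by (intro bij_betw_trans[OF g'] bij_betw_trans[OF r] h(1))
  moreover have "(h \<circ> (\<lambda>k. m - 1 - k) \<circ> g') y < (h \<circ> (\<lambda>k. m - 1 - k) \<circ> g') x"
    if xy: "x \<in> S" "y \<in> S" "x < y" for x y
  proof -
    have "g' x < g' y"
    proof (rule ccontr)
      assume "\<not> g' x < g' y"
      then have "g (g' y) \<le> g (g' x)"
        using g(2) g'm xy by (cases "g' x = g' y") (auto simp: strict_mono_on_def less_imp_le)
      then show False using gg xy by simp
    qed
    then have "m - 1 - g' y < m - 1 - g' x" using g'm[OF xy(2)] by simp
    then show ?thesis using h(2) g'm[OF xy(1)] by (simp add: strict_mono_on_def)
  qed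
  ultimately show ?thesis by blast
qed

text \<open>With \<open>p\<close> the size of \<open>A\<close>, the rows up to \<open>p\<close>
  whose numbers are missing from \<open>A\<close> are as many as the elements of \<open>A\<close>
  above \<open>p\<close>. These elements fill the rows in decreasing order and exceed every entry
  that equals its row number.\<close>

lemma pbw_column_exists:
  assumes A: "A \<subseteq> {1..n}"
  shows "\<exists>c. pbw_column n c \<and> set c = A"
proof -
  define p where "p = card A"
  have fin: "finite A" using A finite_subset by blast
  let ?S = "{1..p} - A" and ?T = "A - {1..p}"
  have "card ?S = card ?T"
    using card_Diff_subset_Int[of "{1..p}" A] card_Diff_subset_Int[of A "{1..p}"] fin
    by (simp add: p_def Int_commute)
  then obtain f where f: "bij_betw f ?S ?T" "\<And>x y. x \<in> ?S \<Longrightarrow> y \<in> ?S \<Longrightarrow> x < y \<Longrightarrow> f y < f x"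
    using antitone_bijection[of ?S ?T] fin by auto
  define g where "g i = (if i \<in> A then i else f i)" for i
  define c where "c = map g [1..<Suc p]"
  have len: "length c = p" by (simp add: c_def)
  have nth: "c ! i = g (Suc i)" if "i < p" for i
    using that by (simp add: c_def del: upt_Suc)
  have big: "f i \<in> A" "p < f i" if "i \<in> {1..p}" "i \<notin> A" for i
    using bij_betwE[OF f(1)] that A by force+
  have set: "set c = A"
  proof -
    have "set c = g ` {1..p}" by (auto simp: c_def)
    also have "{1..p} = (A \<inter> {1..p}) \<union> ?S" by auto
    also have "g ` \<dots> = (A \<inter> {1..p}) \<union> f ` ?S" by (auto simp: g_def image_Un)
    also have "f ` ?S = ?T" using f(1) by (simp add: bij_betw_def)
    finally show ?thesis by auto
  qed
  have "c ! i = Suc i" if "i < p" "c ! i \<le> p" for i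
    using that big[of "Suc i"] by (auto simp: nth g_def split: if_splits)
  moreover have "c ! j < c ! i" if ij: "i < j" "j < p" "c ! i \<noteq> Suc i" for i j
  proof -
    have i: "Suc i \<notin> A" using ij by (auto simp: nth g_def)
    show ?thesis
    proof (cases "Suc j \<in> A")
      case True
      then show ?thesis using big(2)[of "Suc i"] i ij by (simp add: nth g_def)
    next
      case False
      then show ?thesis using f(2)[of "Suc i" "Suc j"] i ij by (simp add: nth g_def)
    qed
  qed
  ultimately have "pbw_column n c" using A set by (simp add: pbw_column_def len)
  with set show ?thesis by blast
qed

text \<open>Row \<open>i\<close> of the height records the largest entry in rows \<open>i, \<dots>, card A\<close> of the PBW column
  with entries \<open>A\<close>.\<close>

definition column_height :: "nat \<Rightarrow> nat set \<Rightarrow> nat \<Rightarrow> nat" where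
  "column_height n A i = Max {j. j \<le> n \<and> i \<le> card (A \<inter> ({..<i} \<union> {j..}))}"

text \<open>Heights are read from the bottom row upwards because an exchange of \<open>k\<close>
  entries is controlled in row \<open>k\<close> and below, not above. They are subtracted from
  \<open>n\<close> so that a gain in height becomes a drop in a well-founded order.\<close>

definition column_rank :: "nat \<Rightarrow> nat set \<Rightarrow> nat list" where
  "column_rank n A = map (\<lambda>i. n - column_height n A i) (rev [1..<Suc (card A)])"

text \<open>Why counting yields heights: the \<open>i - 1\<close> entries above row \<open>i\<close>
  of a PBW column are less than \<open>i\<close> or exceed all later ones, so a later entry of at
  least \<open>j\<close> gives \<open>i\<close> elements of the required kind. Conversely, one of
  \<open>i\<close> such elements sits in row \<open>i\<close> or below; it is not less than
  \<open>i\<close>, hence at least \<open>j\<close>.\<close>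

lemma column_height_ge:
  "j \<le> n \<Longrightarrow> i \<le> card (A \<inter> ({..<i} \<union> {j..})) \<Longrightarrow> j \<le> column_height n A i"
  unfolding column_height_def by (rule Max_ge) auto

lemma column_height_attained:
  assumes "i \<le> card A"
  shows "column_height n A i \<le> n" "i \<le> card (A \<inter> ({..<i} \<union> {column_height n A i..}))"
proof -
  let ?M = "{j. j \<le> n \<and> i \<le> card (A \<inter> ({..<i} \<union> {j..}))}"
  have "{..<i} \<union> {0..} = UNIV" by auto
  then have "0 \<in> ?M" using assms by simp
  then have "Max ?M \<in> ?M" by (intro Max_in) auto
  then show "column_height n A i \<le> n" "i \<le> card (A \<inter> ({..<i} \<union> {column_height n A i..}))"
    by (simp_all add: column_height_def)
qed

lemma lex_less_than_nth:
  assumes "length xs = length ys" "k < length xs" "\<And>m. m < k \<Longrightarrow> xs ! m \<le> ys ! m" "xs ! k < ys ! k"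
  shows "(xs, ys) \<in> lex less_than"
proof -
  define m where "m = (LEAST m. xs ! m < ys ! m)"
  have m: "xs ! m < ys ! m" unfolding m_def by (rule LeastI) (rule assms(4))
  have mk: "m \<le> k" unfolding m_def by (rule Least_le) (rule assms(4))
  have "xs ! i = ys ! i" if "i < m" for i
    using not_less_Least[of i "\<lambda>m. xs ! m < ys ! m"] assms(3)[of i] that mk by (fastforce simp: m_def)
  then have "take m xs = take m ys" using assms mk by (intro nth_take_lemma) auto
  moreover have "xs = take m xs @ xs ! m # drop (Suc m) xs" "ys = take m ys @ ys ! m # drop (Suc m) ys"
    using assms(1,2) mk by (simp_all add: id_take_nth_drop)
  ultimately show ?thesis using m assms(1) unfolding lex_conv by fastforce
qed

text \<open>An exchange that brings the set \<open>S\<close> of the first \<open>k\<close> entries of the violating column into \<open>A\<close>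
  raises the height in row \<open>k\<close> and lowers none below it.\<close>

lemma column_rank_decreases:
  assumes fin: "finite A" "finite A'" and card: "card A' = card A"
    and k: "1 \<le> k" "k \<le> card A" and S: "S \<subseteq> A'" "A' \<subseteq> A \<union> S" "card S = k"
    and U: "S \<subseteq> {..<k} \<union> {j..}" and j: "j \<le> n" "column_height n A k < j"
  shows "(column_rank n A', column_rank n A) \<in> lex less_than"
proof (rule lex_less_than_nth)
  let ?p = "card A"
  show "length (column_rank n A') = length (column_rank n A)" by (simp add: column_rank_def card)
  show "?p - k < length (column_rank n A')" using k by (simp add: column_rank_def card)
  have nth: "column_rank n B ! m = n - column_height n B (?p - m)" if "m < ?p" "card B = ?p" for m B
    using that by (simp add: column_rank_def rev_nth Suc_diff_Suc del: upt_Suc)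
  have "card S \<le> card (A' \<inter> ({..<k} \<union> {j..}))"
    by (rule card_mono) (use fin S U in auto)
  then have up: "j \<le> column_height n A' k"
    by (intro column_height_ge j) (simp add: S)
  then show "column_rank n A' ! (?p - k) < column_rank n A ! (?p - k)"
    using k j column_height_attained(1)[of k A' n] by (simp add: nth card)
  fix m assume m: "m < ?p - k"
  let ?i = "?p - m"
  have i: "k < ?i" "?i \<le> ?p" using m by simp_all
  let ?h = "column_height n A ?i"
  have h: "?h \<le> n" "?i \<le> card (A \<inter> ({..<?i} \<union> {?h..}))"
    using column_height_attained[of ?i A n] by simp_all
  have "?h \<le> column_height n A' ?i"
  \<comment> \<open>If \<open>?h \<le> j\<close>, all elements of \<open>S\<close> count for row
    \<open>?i\<close>, and with equal cardinalities the count cannot fall. The case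
    \<open>?h > j\<close> is impossible: at most \<open>?i - k\<close> of the at least
    \<open>?i\<close> counted elements lie in \<open>{k..<?i}\<close>, and the remaining ones would
    give row \<open>k\<close> a height of at least \<open>j\<close>.\<close>
  proof (cases "?h \<le> j")
    case True
    let ?V = "{..<?i} \<union> {?h..}"
    have "S \<subseteq> ?V" using U i True by auto
    then have "A' - ?V \<subseteq> A - ?V" using S by auto
    then have "card (A' - ?V) \<le> card (A - ?V)" using fin by (intro card_mono) auto
    moreover have "card (B \<inter> ?V) = card B - card (B - ?V)" if "finite B" for B
      using card_Int_Diff[OF that, of ?V] by simp
    ultimately have "card (A \<inter> ?V) \<le> card (A' \<inter> ?V)" using fin card by (simp add: diff_le_mono2)
    then show ?thesis using h by (intro column_height_ge) auto
  next
    case False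
    have "A \<inter> ({..<?i} \<union> {?h..}) \<subseteq> (A \<inter> ({..<k} \<union> {j..})) \<union> {k..<?i}" using False by auto
    then have "card (A \<inter> ({..<?i} \<union> {?h..})) \<le> card ((A \<inter> ({..<k} \<union> {j..})) \<union> {k..<?i})"
      using fin by (intro card_mono) auto
    also have "\<dots> \<le> card (A \<inter> ({..<k} \<union> {j..})) + card {k..<?i}" by (rule card_Un_le)
    finally have "k \<le> card (A \<inter> ({..<k} \<union> {j..}))" using h(2) i by simp
    then have "j \<le> column_height n A k" using j(1) by (intro column_height_ge)
    then show ?thesis using j(2) by simp
  qed
  then show "column_rank n A' ! m \<le> column_rank n A ! m"
    using m by (simp add: nth card diff_le_mono2)
qed

text \<open>Entries at list positions from \<open>i\<close> on are at least \<open>i + 1\<close> and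
  less than \<open>j\<close>. If the height reached \<open>j\<close>, every counted element would
  have to come from the \<open>i\<close> positions before, one too few.\<close>

lemma violation_height:
  assumes L: "pbw_column n L" and i: "i < length L"
    and below: "\<And>i1. i \<le> i1 \<Longrightarrow> i1 < length L \<Longrightarrow> L ! i1 < j"
  shows "column_height n (set L) (Suc i) < j"
proof (rule ccontr)
  let ?h = "column_height n (set L) (Suc i)"
  assume a: "\<not> ?h < j"
  have "card (set L) = length L" using pbw_column_distinct[OF L] by (rule distinct_card)
  then have "Suc i \<le> card (set L \<inter> ({..<Suc i} \<union> {?h..}))"
    using i by (intro column_height_attained) simp
  also have "\<dots> \<le> card ((!) L ` {..<i})"
  proof (rule card_mono)
    show "set L \<inter> ({..<Suc i} \<union> {?h..}) \<subseteq> (!) L ` {..<i}"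
    proof
      fix x assume x: "x \<in> set L \<inter> ({..<Suc i} \<union> {?h..})"
      then obtain b where b: "b < length L" "x = L ! b" by (auto simp: in_set_conv_nth)
      have "b < i"
      proof (rule ccontr)
        assume "\<not> b < i"
        then have "x < j" "Suc i \<le> x" using below[of b] b pbw_column_ge[OF L, of b] by simp_all
        then show False using x a by simp
      qed
      then show "x \<in> (!) L ` {..<i}" using b by simp
    qed
  qed simp
  also have "\<dots> \<le> i" using card_image_le[of "{..<i}" "(!) L"] by simp
  finally show False by simp
qed

lemma exchange_left_in_set:
  assumes "distinct r" "set r \<subseteq> {..<length L}" and lenJ: "length r \<le> length J"
  shows "set (take (length r) J) \<subseteq> set (exchange_left r L J)"
    and "set (exchange_left r L J) \<subseteq> set L \<union> set (take (length r) J)"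
proof -
  show "set (take (length r) J) \<subseteq> set (exchange_left r L J)"
  proof
    fix x assume "x \<in> set (take (length r) J)"
    then obtain a where a: "a < length r" "x = J ! a" using lenJ by (auto simp: in_set_conv_nth)
    then have "r ! a < length L" using assms(2) nth_mem by blast
    moreover from this have "exchange_left r L J ! (r ! a) = x"
      using a assms by (simp add: exchange_left_nth replace_rows_nth)
    ultimately show "x \<in> set (exchange_left r L J)"
      by (metis exchange_left_facts(1) nth_mem)
  qed
  show "set (exchange_left r L J) \<subseteq> set L \<union> set (take (length r) J)"
  proof
    fix x assume "x \<in> set (exchange_left r L J)"
    then obtain b where b: "b < length L" "x = exchange_left r L J ! b"
      by (auto simp: in_set_conv_nth exchange_left_facts(1))
    show "x \<in> set L \<union> set (take (length r) J)"
    proof (cases "b \<in> set r")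
      case True
      then obtain a where "a < length r" "b = r ! a" by (auto simp: in_set_conv_nth)
      then have "x = J ! a" "a < length (take (length r) J)" "a < length r"
        using b assms by (simp_all add: exchange_left_nth replace_rows_nth)
      then show ?thesis by (metis UnI2 nth_mem nth_take)
    next
      case False
      then show ?thesis using b assms by (simp add: exchange_left_nth replace_rows_notin)
    qed
  qed
qed

section \<open>The straightening procedure\<close>

lemma zero_in_ideal: "0 \<in> degenerate_plucker_ideal n D"
  using additive_subgroup.zero_closed[OF ideal.axioms(1)[OF degenerate_plucker_ideal_ideal], of n D]
  by simp

text \<open>The preimage in the polynomial ring of the span of the standard classes. Working there
  keeps cosets out of the straightening.\<close>

inductive_set standard_span :: "nat \<Rightarrow> nat set \<Rightarrow> plucker_poly set" for n D where
  ideal: "f \<in> degenerate_plucker_ideal n D \<Longrightarrow> f \<in> standard_span n D"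
| standard: "cs \<in> standard_columns n D \<Longrightarrow> prod_list (map plucker_var cs) \<in> standard_span n D"
| add: "f \<in> standard_span n D \<Longrightarrow> g \<in> standard_span n D \<Longrightarrow> f + g \<in> standard_span n D"
| scale: "f \<in> standard_span n D \<Longrightarrow> const_poly c * f \<in> standard_span n D"

lemma standard_span_zero: "0 \<in> standard_span n D"
  by (rule standard_span.ideal[OF zero_in_ideal])

lemma standard_span_uminus: "f \<in> standard_span n D \<Longrightarrow> - f \<in> standard_span n D"
  using standard_span.scale[of f n D "- 1"] by (simp add: const_poly_def single_uminus)

lemma standard_span_sum:
  "(\<And>i. i \<in> S \<Longrightarrow> f i \<in> standard_span n D) \<Longrightarrow> sum f S \<in> standard_span n D"
  by (induction S rule: infinite_finite_induct) (auto simp: standard_span_zero standard_span.add)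

lemma plucker_var_same_set:
  assumes "distinct L" "distinct L'" "set L = set L'"
  shows "plucker_var L = plucker_var L' \<or> plucker_var L = - plucker_var L'"
proof -
  have "(- 1 :: plucker_poly) ^ k = 1 \<or> (- 1 :: plucker_poly) ^ k = - 1" for k
    by (induction k) auto
  from this[of "card (inversions L)"] this[of "card (inversions L')"] show ?thesis
    using assms by (auto simp: plucker_var_def)
qed

lemma prod_list_same_up_to_sign:
  fixes xs ys :: "'a::comm_ring_1 list"
  assumes "list_all2 (\<lambda>x y. x = y \<or> x = - y) xs ys"
  shows "prod_list xs = prod_list ys \<or> prod_list xs = - prod_list ys"
  using assms by (induction rule: list_all2_induct) auto

lemma prod_list_plucker_var_in:
  assumes "\<And>L. L \<in> set Ls \<Longrightarrow> set L \<subseteq> {1..n} \<and> length L \<in> D"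
  shows "prod_list (map plucker_var Ls) \<in> carrier (plucker_ring n D)"
  using assms by (induction Ls) (simp_all add: one_in mult_in plucker_var_in)

text \<open>The row in which domination fails fixes \<open>k\<close>. The entries of
  \<open>J\<close> above that row equal their row numbers or exceed the violating entry, which gives
  \<epsilon> = 1 and raises the height of the left column. Of the right column only length and range
  are recorded. A left column with a repetition gives a zero summand and is exempt from the
  descent.\<close>

lemma straighten_pair:
  assumes L: "pbw_column n L" "length L \<in> D" and J: "pbw_column n J" "length J \<in> D"
    and le: "length J \<le> length L" and viol: "\<not> dominates L J"
  shows "\<exists>R. finite R \<and>
    plucker_var L * plucker_var J -
      (\<Sum>r\<in>R. plucker_var (exchange_left r L J) * plucker_var (exchange_right r L J))
      \<in> degenerate_plucker_ideal n D \<and>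
    (\<forall>r\<in>R. set (exchange_left r L J) \<subseteq> {1..n} \<and> set (exchange_right r L J) \<subseteq> {1..n} \<and>
      length (exchange_right r L J) = length J \<and>
      (distinct (exchange_left r L J) \<longrightarrow>
        (column_rank n (set (exchange_left r L J)), column_rank n (set L)) \<in> lex less_than))"
proof -
  define p q where "p = length L" and "q = length J"
  obtain i where i: "i < q" "\<And>i1. i \<le> i1 \<Longrightarrow> i1 < p \<Longrightarrow> L ! i1 < J ! i"
    using viol le unfolding dominates_def p_def q_def by (meson not_le)
  define k where "k = Suc i"
  define j where "j = J ! i"
  define R where "R = {r. length r = k \<and> sorted_wrt (<) r \<and> set r \<subseteq> {..<p} \<and>
    (\<lambda>a. L ! a) ` set r \<inter> {q + 1..p} = {}}"
  have distL: "distinct L" and distJ: "distinct J" using L J by (simp_all add: pbw_column_distinct)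
  have setL: "set L \<subseteq> {1..n}" and setJ: "set J \<subseteq> {1..n}" using L J by (auto simp: pbw_column_def)
  have pq: "q \<le> p" "i < p" "k \<le> q" using le i by (simp_all add: p_def q_def k_def)
  \<comment> \<open>The last entry of \<open>L\<close> is at least its row number \<open>p\<close>
    and, by the violation, less than \<open>j\<close>.\<close>
  have jp: "p < j"
  proof -
    have "p - 1 < length L" "i \<le> p - 1" using pq by (simp_all add: p_def)
    then show ?thesis
      using i(2)[of "p - 1"] pbw_column_ge[OF L(1), of "p - 1"] unfolding j_def p_def by linarith
  qed
  have S: "set (take k J) \<subseteq> {..<k} \<union> {j..}"
  proof
    fix x assume "x \<in> set (take k J)"
    then have "\<exists>a\<le>i. x = J ! a" by (auto simp: in_set_conv_nth k_def less_Suc_eq_le)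
    then obtain a where a: "a \<le> i" "x = J ! a" by blast
    show "x \<in> {..<k} \<union> {j..}"
    proof (cases "a = i")
      case False
      then have "a < i" using a by simp
      moreover have "j < x" if "J ! a \<noteq> Suc a"
        using J(1) \<open>a < i\<close> i(1) a that by (auto simp: pbw_column_def j_def q_def)
      ultimately show ?thesis using a by (cases "J ! a = Suc a") (auto simp: k_def)
    qed (simp add: a j_def)
  qed
  \<comment> \<open>Numbers below \<open>k \<le> q\<close> and numbers from \<open>j > p\<close> on
    avoid the forbidden interval, so the relation has \<epsilon> = 1.\<close>
  then have eps: "set (take k J) \<inter> {q + 1..p} = {}" using pq jp by auto
  have cardS: "card (set (take k J)) = k" using distJ pq by (simp add: distinct_card q_def)
  have "j \<in> {1..n}" using setJ i(1) nth_mem[of i J] unfolding j_def q_def by blast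
  then have jn: "j \<le> n" by simp
  have height: "column_height n (set L) k < j"
    unfolding k_def using violation_height[OF L(1)] pq i(2) by (simp add: p_def j_def)
  have R: "R \<subseteq> position_lists k p" by (auto simp: R_def position_lists_def strict_sorted_iff)
  then have "finite R" by (rule finite_subset) simp
  moreover have "plucker_var L * plucker_var J -
      (\<Sum>r\<in>R. plucker_var (exchange_left r L J) * plucker_var (exchange_right r L J))
      \<in> degenerate_plucker_ideal n D"
  proof -
    have "degenerate_plucker_relation k L J \<in> degenerate_plucker_relations n D"
      unfolding degenerate_plucker_relations_def
      using L J le pq distL distJ setL setJ by (auto simp: k_def q_def)
    then have "degenerate_plucker_relation k L J \<in> degenerate_plucker_ideal n D"
      unfolding degenerate_plucker_ideal_def
      using ring.genideal_self[OF cring.axioms(1)[OF plucker_cring] relations_in] by blast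
    then show ?thesis
      using eps by (simp add: degenerate_plucker_relation_def R_def p_def q_def Let_def)
  qed
  moreover have "set (exchange_left r L J) \<subseteq> {1..n} \<and> set (exchange_right r L J) \<subseteq> {1..n} \<and>
      length (exchange_right r L J) = length J \<and>
      (distinct (exchange_left r L J) \<longrightarrow>
        (column_rank n (set (exchange_left r L J)), column_rank n (set L)) \<in> lex less_than)"
    if "r \<in> R" for r
  proof (intro conjI impI)
    have r: "length r = k" "distinct r" "set r \<subseteq> {..<length L}"
      using R that by (auto simp: position_lists_def p_def)
    have kJ: "length r \<le> length J" using r pq by (simp add: q_def)
    have "(\<lambda>a. L ! a) ` set r \<subseteq> set L" using r by auto
    then show "set (exchange_left r L J) \<subseteq> {1..n}" "set (exchange_right r L J) \<subseteq> {1..n}"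
      using exchange_left_facts(2)[OF kJ, of L] setL setJ set_drop_subset[of "length r" J]
      unfolding exchange_right_def set_append set_map by blast+
    show "length (exchange_right r L J) = length J"
      using kJ by (simp add: exchange_right_def)
    assume dist: "distinct (exchange_left r L J)"
    show "(column_rank n (set (exchange_left r L J)), column_rank n (set L)) \<in> lex less_than"
    proof (rule column_rank_decreases)
      show "card (set (exchange_left r L J)) = card (set L)"
        using dist distL by (simp add: distinct_card exchange_left_facts(1))
      show "k \<le> card (set L)" using distL pq by (simp add: distinct_card p_def)
      show "set (take k J) \<subseteq> set (exchange_left r L J)"
        "set (exchange_left r L J) \<subseteq> set L \<union> set (take k J)"
        using exchange_left_in_set[OF r(2,3) kJ] r(1) by simp_all
      show "column_height n (set L) k < j" by (rule height)
    qed (use S cardS jn in \<open>simp_all add: k_def\<close>)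
  qed
  ultimately show ?thesis by blast
qed

text \<open>An exchange keeps all column lengths and lowers the rank of the left column, while the
  ranks after it may grow; the concatenation still drops. \<open>lex\<close> compares only lists of
  equal length, which makes it well-founded.\<close>

lemma straighten:
  assumes "\<And>L. L \<in> set Ls \<Longrightarrow> distinct L \<and> set L \<subseteq> {1..n} \<and> length L \<in> D"
    and "sorted_wrt (\<lambda>L L'. length L' \<le> length L) Ls"
  shows "prod_list (map plucker_var Ls) \<in> standard_span n D"
  using assms
proof (induction "concat (map (column_rank n \<circ> set) Ls)" arbitrary: Ls rule: wf_induct_rule[OF wf_lex[OF wf_less_than]])
  case (1 Ls)
  have "\<forall>L\<in>set Ls. \<exists>c. pbw_column n c \<and> set c = set L"
    using 1(2) pbw_column_exists by blast
  then obtain col where col: "pbw_column n (col L)" "set (col L) = set L" if "L \<in> set Ls" for L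
    by metis
  \<comment> \<open>Rearranging a factor into a PBW column costs at most a sign and keeps the rank,
    which depends only on the set of entries.\<close>
  define cs where "cs = map col Ls"
  have len: "length (col L) = length L" if "L \<in> set Ls" for L
    using that 1(2)[of L] col[of L] pbw_column_distinct[of n "col L"] by (metis distinct_card)
  have cs: "pbw_column n c \<and> length c \<in> D" if "c \<in> set cs" for c
    using that col len 1(2) by (auto simp: cs_def)
  have sorted: "sorted_wrt (\<lambda>L L'. length L' \<le> length L) cs"
    unfolding cs_def sorted_wrt_map using 1(3) len by (auto elim!: sorted_wrt_mono_rel[rotated])
  have ranks: "map (column_rank n \<circ> set) cs = map (column_rank n \<circ> set) Ls"
    using col by (simp add: cs_def)
  have "prod_list (map plucker_var cs) \<in> standard_span n D"
  proof (cases "\<forall>j. Suc j < length cs \<longrightarrow> dominates (cs ! j) (cs ! Suc j)")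
    case True
    then have "cs \<in> standard_columns n D"
      using cs sorted_wrt_dominatesI[of cs] by (simp add: standard_columns_def)
    then show ?thesis by (rule standard_span.standard)
  next
    case False
    then obtain j where j: "Suc j < length cs" "\<not> dominates (cs ! j) (cs ! Suc j)" by blast
    define xs ys L J where "xs = take j cs" and "ys = drop (Suc (Suc j)) cs"
      and "L = cs ! j" and "J = cs ! Suc j"
    have split: "cs = xs @ [L, J] @ ys"
      using j(1) by (simp add: xs_def ys_def L_def J_def Cons_nth_drop_Suc)
    have le: "length J \<le> length L" using sorted split by (simp add: sorted_wrt_append)
    have LJ: "pbw_column n L" "length L \<in> D" "pbw_column n J" "length J \<in> D"
      using cs split by auto
    obtain R where R: "finite R"
      "plucker_var L * plucker_var J -
        (\<Sum>r\<in>R. plucker_var (exchange_left r L J) * plucker_var (exchange_right r L J))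
        \<in> degenerate_plucker_ideal n D"
      "\<forall>r\<in>R. set (exchange_left r L J) \<subseteq> {1..n} \<and> set (exchange_right r L J) \<subseteq> {1..n} \<and>
        length (exchange_right r L J) = length J \<and>
        (distinct (exchange_left r L J) \<longrightarrow>
          (column_rank n (set (exchange_left r L J)), column_rank n (set L)) \<in> lex less_than)"
      using straighten_pair[OF LJ le j(2)[folded L_def J_def]] by blast
    define P where "P = prod_list (map plucker_var (xs @ ys))"
    have sub: "set c \<subseteq> {1..n}" if "c \<in> set cs" for c using cs[OF that] by (simp add: pbw_column_def)
    have P: "P \<in> carrier (plucker_ring n D)"
      unfolding P_def by (rule prod_list_plucker_var_in) (use cs sub split in auto)
    interpret ideal "degenerate_plucker_ideal n D" "plucker_ring n D" by (rule degenerate_plucker_ideal_ideal)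
    let ?T = "\<lambda>r. P * (plucker_var (exchange_left r L J) * plucker_var (exchange_right r L J))"
    have "P * (plucker_var L * plucker_var J -
        (\<Sum>r\<in>R. plucker_var (exchange_left r L J) * plucker_var (exchange_right r L J))) \<in> standard_span n D"
      using standard_span.ideal[OF I_l_closed[OF R(2) P]] by simp
    moreover have "?T r \<in> standard_span n D" if r: "r \<in> R" for r
    proof (cases "distinct (exchange_left r L J) \<and> distinct (exchange_right r L J)")
      case True
      let ?L = "exchange_left r L J" and ?J = "exchange_right r L J"
      let ?Ms = "xs @ [?L, ?J] @ ys"
      have lens: "length ?L = length L" "length ?J = length J"
        using bspec[OF R(3) r] by (simp_all add: exchange_left_facts(1))
      have rank: "length (column_rank n (set M)) = length M" if "distinct M" for M
        using that by (simp add: column_rank_def distinct_card del: upt_Suc)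
      have "prod_list (map plucker_var ?Ms) \<in> standard_span n D"
      proof (rule 1(1))
        have "(column_rank n (set ?L) @ (column_rank n (set ?J) @ concat (map (column_rank n \<circ> set) ys)),
            column_rank n (set L) @ (column_rank n (set J) @ concat (map (column_rank n \<circ> set) ys))) \<in> lex less_than"
          by (rule lex_append_rightI)
            (use True lens rank pbw_column_distinct LJ R(3) r in auto)
        then have "(concat (map (column_rank n \<circ> set) ?Ms), concat (map (column_rank n \<circ> set) cs)) \<in> lex less_than"
          unfolding split by (auto intro: lex_append_leftI)
        then show "(concat (map (column_rank n \<circ> set) ?Ms), concat (map (column_rank n \<circ> set) Ls)) \<in> lex less_than"
          by (simp only: ranks)
        show "distinct M \<and> set M \<subseteq> {1..n} \<and> length M \<in> D" if M: "M \<in> set ?Ms" for M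
        proof -
          have "M \<in> set cs \<or> M = ?L \<or> M = ?J" using M split by auto
          then show ?thesis
            using cs[of M] sub[of M] pbw_column_distinct[of n M] True bspec[OF R(3) r] lens LJ by auto
        qed
        show "sorted_wrt (\<lambda>L L'. length L' \<le> length L) ?Ms"
          using sorted lens unfolding split by (simp add: sorted_wrt_append)
      qed
      then show ?thesis by (simp add: P_def mult_ac)
    next
      case False
      then have "?T r = 0" by (auto simp: plucker_var_def)
      then show ?thesis by (simp add: standard_span_zero)
    qed
    ultimately have "P * (plucker_var L * plucker_var J -
        (\<Sum>r\<in>R. plucker_var (exchange_left r L J) * plucker_var (exchange_right r L J)))
        + (\<Sum>r\<in>R. ?T r) \<in> standard_span n D"
      by (intro standard_span.add standard_span_sum)
    also have "P * (plucker_var L * plucker_var J -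
        (\<Sum>r\<in>R. plucker_var (exchange_left r L J) * plucker_var (exchange_right r L J)))
        + (\<Sum>r\<in>R. ?T r) = prod_list (map plucker_var cs)"
      unfolding split by (simp add: P_def algebra_simps sum_distrib_left)
    finally show ?thesis .
  qed
  moreover have lists: "list_all2 (\<lambda>x y. x = y \<or> x = - y) (map plucker_var Ls) (map plucker_var cs)"
  proof -
    have "plucker_var L = plucker_var (col L) \<or> plucker_var L = - plucker_var (col L)" if "L \<in> set Ls" for L
      using plucker_var_same_set[of L "col L"] pbw_column_distinct[OF col(1)[OF that]] col(2)[OF that] 1(2)[OF that] by simp
    then show ?thesis by (simp add: cs_def list_all2_conv_all_nth)
  qed
  ultimately show ?case
    using prod_list_same_up_to_sign[OF lists] standard_span_uminus[of "prod_list (map plucker_var cs)"] by auto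
qed

section \<open>Every polynomial reduces to standard monomials\<close>

definition set_var :: "nat set \<Rightarrow> plucker_poly" where
  "set_var A = Poly_Mapping.single (Poly_Mapping.single A 1) 1"

lemma single_eq_prod_list_set_var:
  "\<exists>As. set As \<subseteq> Poly_Mapping.keys m \<and> Poly_Mapping.single m (1::complex) = prod_list (map set_var As)"
proof -
  have pow: "set_var A ^ e = Poly_Mapping.single (Poly_Mapping.single A e) 1" for A e
    by (induction e) (simp_all add: set_var_def mult_single single_add[symmetric])
  have "\<exists>As. set As \<subseteq> K \<and>
      Poly_Mapping.single (\<Sum>A\<in>K. Poly_Mapping.single A (e A)) (1::complex) = prod_list (map set_var As)"
    if "finite K" for K and e :: "nat set \<Rightarrow> nat"
    using that
  proof (induction K)
    case empty
    show ?case by (intro exI[of _ "[]"]) simp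
  next
    case (insert A K)
    then obtain As where As: "set As \<subseteq> K"
      "Poly_Mapping.single (\<Sum>A\<in>K. Poly_Mapping.single A (e A)) (1::complex) = prod_list (map set_var As)"
      by blast
    have "Poly_Mapping.single (\<Sum>A\<in>insert A K. Poly_Mapping.single A (e A)) (1::complex) =
        Poly_Mapping.single (Poly_Mapping.single A (e A)) 1 *
        Poly_Mapping.single (\<Sum>A\<in>K. Poly_Mapping.single A (e A)) 1"
      using insert by (simp add: mult_single)
    also have "\<dots> = prod_list (map set_var (replicate (e A) A @ As))"
      by (simp add: As(2) pow prod_list_replicate)
    finally show ?case using As(1) by (intro exI[of _ "replicate (e A) A @ As"]) (auto split: if_splits)
  qed
  from this[of "Poly_Mapping.keys m" "Poly_Mapping.lookup m"] show ?thesis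
    by (simp flip: poly_mapping_sum_singles)
qed

lemma single_in_standard_span:
  assumes m: "Poly_Mapping.keys m \<subseteq> plucker_indices n D"
  shows "Poly_Mapping.single m 1 \<in> standard_span n D"
proof -
  obtain As where As: "set As \<subseteq> Poly_Mapping.keys m"
    "Poly_Mapping.single m (1::complex) = prod_list (map set_var As)"
    using single_eq_prod_list_set_var by blast
  \<comment> \<open>Straightening expects weakly decreasing column lengths. Since sizes are at most
    \<open>n\<close>, ascending order by \<open>n - card A\<close> provides them.\<close>
  define Bs where "Bs = sort_key (\<lambda>A. n - card A) As"
  have B: "finite A" "A \<subseteq> {1..n}" "card A \<in> D" "card A \<le> n" if "A \<in> set Bs" for A
  proof -
    have "A \<in> plucker_indices n D" using that As(1) m by (auto simp: Bs_def)
    then show "A \<subseteq> {1..n}" "card A \<in> D" by (auto simp: plucker_indices_def)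
    then show "finite A" "card A \<le> n"
      using finite_subset[of A "{1..n}"] card_mono[of "{1..n}" A] by auto
  qed
  have "mset (map set_var Bs) = mset (map set_var As)" by (simp add: Bs_def)
  then have eq: "Poly_Mapping.single m (1::complex) = prod_list (map set_var Bs)"
    unfolding As(2) by (metis prod_mset_prod_list)
  define Ls where "Ls = map sorted_list_of_set Bs"
  have "prod_list (map plucker_var Ls) \<in> standard_span n D"
  proof (rule straighten)
    fix L assume "L \<in> set Ls"
    then obtain A where A: "A \<in> set Bs" "L = sorted_list_of_set A" by (auto simp: Ls_def)
    then show "distinct L \<and> set L \<subseteq> {1..n} \<and> length L \<in> D" using B[OF A(1)] by simp
  next
    have "sorted (map (\<lambda>A. n - card A) Bs)" unfolding Bs_def by (rule sorted_sort_key)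
    then have "sorted_wrt (\<lambda>A B. n - card A \<le> n - card B) Bs" by (simp add: sorted_map)
    then show "sorted_wrt (\<lambda>L L'. length L' \<le> length L) Ls"
      unfolding Ls_def sorted_wrt_map
      by (rule sorted_wrt_mono_rel[rotated]) (use B in \<open>fastforce simp: sorted_list_of_set.length_sorted_key_list_of_set\<close>)
  qed
  moreover have lists: "list_all2 (\<lambda>x y. x = y \<or> x = - y) (map set_var Bs) (map plucker_var Ls)"
  proof -
    have "set_var A = plucker_var (sorted_list_of_set A) \<or> set_var A = - plucker_var (sorted_list_of_set A)"
      if "A \<in> set Bs" for A
    proof -
      have "(- 1 :: plucker_poly) ^ k = 1 \<or> (- 1 :: plucker_poly) ^ k = - 1" for k
        by (induction k) auto
      from this[of "card (inversions (sorted_list_of_set A))"] show ?thesis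
        using B(1)[OF that] by (auto simp: plucker_var_def set_var_def)
    qed
    then show ?thesis by (simp add: list_all2_conv_all_nth Ls_def)
  qed
  ultimately show ?thesis
    unfolding eq
    using prod_list_same_up_to_sign[OF lists] standard_span_uminus[of "prod_list (map plucker_var Ls)"] by auto
qed

lemma carrier_subset_standard_span: "carrier (plucker_ring n D) \<subseteq> standard_span n D"
proof
  fix f assume f: "f \<in> carrier (plucker_ring n D)"
  have "Poly_Mapping.single m (Poly_Mapping.lookup f m) \<in> standard_span n D"
    if "m \<in> Poly_Mapping.keys f" for m
  proof -
    have "const_poly (Poly_Mapping.lookup f m) * Poly_Mapping.single m 1 \<in> standard_span n D"
      by (intro standard_span.scale single_in_standard_span) (use f that in \<open>simp add: plucker_ring_def\<close>)
    then show ?thesis by (simp add: const_poly_def mult_single)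
  qed
  then have "(\<Sum>m\<in>Poly_Mapping.keys f. Poly_Mapping.single m (Poly_Mapping.lookup f m)) \<in> standard_span n D"
    by (rule standard_span_sum)
  then show "f \<in> standard_span n D" by (simp only: poly_mapping_sum_singles[symmetric])
qed

section \<open>The basis\<close>

text \<open>The polynomials that evaluate to 0 form an ideal that contains all relations, hence the
  ideal generated by them.\<close>

lemma plucker_eval_ideal:
  assumes "f \<in> degenerate_plucker_ideal n D"
  shows "plucker_eval f = 0"
proof -
  let ?R = "plucker_ring n D" and ?K = "{f \<in> carrier (plucker_ring n D). plucker_eval f = 0}"
  interpret cring ?R by (rule plucker_cring)
  have uminus: "\<ominus>\<^bsub>?R\<^esub> x = - x" if "x \<in> carrier ?R" for x
    using that by (intro minus_equality) (simp_all add: uminus_in)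
  have "ideal ?K ?R"
  proof (rule idealI)
    show "subgroup ?K (add_monoid ?R)"
      by (rule add.subgroupI)
        (auto simp: uminus zero_in add_in uminus_in plucker_eval_def poly_subst_add poly_subst_uminus
          simp flip: a_inv_def intro!: exI[of _ 0])
  qed (auto simp: mult_in plucker_eval_def poly_subst_mult intro: ring_axioms)
  moreover have "degenerate_plucker_relations n D \<subseteq> ?K"
    using relations_in plucker_eval_relation by (fastforce simp: degenerate_plucker_relations_def)
  ultimately have "degenerate_plucker_ideal n D \<subseteq> ?K"
    unfolding degenerate_plucker_ideal_def by (rule genideal_minimal)
  with assms show ?thesis by blast
qed

section \<open>The quotient algebra and its basis\<close>

lemma quotient_class_eqD:
  assumes "f \<in> carrier (plucker_ring n D)" "g \<in> carrier (plucker_ring n D)"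
    and "quotient_class n D f = quotient_class n D g"
  shows "f - g \<in> degenerate_plucker_ideal n D"
proof -
  interpret ideal "degenerate_plucker_ideal n D" "plucker_ring n D" by (rule degenerate_plucker_ideal_ideal)
  have "f \<in> quotient_class n D g"
    using a_rcos_self[OF assms(1)] assms(3) by (simp add: quotient_class_def)
  then show ?thesis by (auto simp: quotient_class_def a_r_coset_def')
qed

lemma quotient_class_ideal:
  assumes "f \<in> degenerate_plucker_ideal n D"
  shows "quotient_class n D f = degenerate_plucker_ideal n D"
proof -
  interpret ideal "degenerate_plucker_ideal n D" "plucker_ring n D" by (rule degenerate_plucker_ideal_ideal)
  show ?thesis unfolding quotient_class_def by (rule a_rcos_const[OF assms])
qed

lemma degenerate_plucker_algebra_simps:
  "carrier (degenerate_plucker_algebra n D) = quotient_class n D ` carrier (plucker_ring n D)"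
  "zero (degenerate_plucker_algebra n D) = quotient_class n D 0"
  "f \<in> carrier (plucker_ring n D) \<Longrightarrow> g \<in> carrier (plucker_ring n D) \<Longrightarrow>
    add (degenerate_plucker_algebra n D) (quotient_class n D f) (quotient_class n D g) =
      quotient_class n D (f + g)"
  "f \<in> carrier (plucker_ring n D) \<Longrightarrow>
    module.smult (degenerate_plucker_algebra n D) c (quotient_class n D f) =
      quotient_class n D (const_poly c * f)"
proof -
  interpret I: ideal "degenerate_plucker_ideal n D" "plucker_ring n D" by (rule degenerate_plucker_ideal_ideal)
  have hom: "quotient_class n D \<in> Ring.ring_hom (plucker_ring n D) (plucker_ring n D Quot degenerate_plucker_ideal n D)"
    unfolding quotient_class_def by (rule I.rcos_ring_hom)
  show "carrier (degenerate_plucker_algebra n D) = quotient_class n D ` carrier (plucker_ring n D)"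
    by (auto simp: degenerate_plucker_algebra_def ring.defs module.defs FactRing_def A_RCOSETS_def'
        quotient_class_def)
  show "zero (degenerate_plucker_algebra n D) = quotient_class n D 0"
    using quotient_class_ideal[OF zero_in_ideal]
    by (simp add: degenerate_plucker_algebra_def ring.defs module.defs FactRing_def)
  show "add (degenerate_plucker_algebra n D) (quotient_class n D f) (quotient_class n D g) =
      quotient_class n D (f + g)"
    if "f \<in> carrier (plucker_ring n D)" "g \<in> carrier (plucker_ring n D)"
    using ring_hom_add[OF hom that]
    by (simp add: degenerate_plucker_algebra_def ring.defs module.defs)
  show "module.smult (degenerate_plucker_algebra n D) c (quotient_class n D f) =
      quotient_class n D (const_poly c * f)" if "f \<in> carrier (plucker_ring n D)"
    using ring_hom_mult[OF hom const_in that, of c]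
    by (simp add: degenerate_plucker_algebra_def ring.defs module.defs)
qed

definition column_class :: "nat \<Rightarrow> nat set \<Rightarrow> nat list list \<Rightarrow> plucker_poly set" where
  "column_class n D cs = quotient_class n D (prod_list (map plucker_var cs))"

lemma standard_monomial_in:
  "cs \<in> standard_columns n D \<Longrightarrow> prod_list (map plucker_var cs) \<in> carrier (plucker_ring n D)"
  by (rule prod_list_plucker_var_in) (auto simp: standard_columns_def pbw_column_def)

lemma standard_monomials_independent:
  assumes D: "D \<subseteq> {..n}" and S: "finite S" "S \<subseteq> standard_columns n D"
    and rel: "(\<Sum>cs\<in>S. const_poly (a cs) * prod_list (map plucker_var cs)) \<in> degenerate_plucker_ideal n D"
  shows "\<forall>cs\<in>S. a cs = 0"
proof (rule independent_of_leading[OF S(1)])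
  let ?F = "\<lambda>cs. plucker_eval (prod_list (map plucker_var cs))"
  show "inj_on (\<lambda>cs. sum_list (map leading_monomial cs)) S"
    by (rule inj_onI) (use S(2) leading_monomials_inj in blast)
  show "has_leading (coordinate_weight n) (?F cs) (sum_list (map leading_monomial cs))" if "cs \<in> S" for cs
    using standard_columns_leading[OF D] that S(2) by blast
  fix m
  have const: "plucker_eval (const_poly c * f) = Poly_Mapping.single 0 c * plucker_eval f" for c f
    by (simp add: plucker_eval_def poly_subst_mult const_poly_def poly_subst_single)
  have scale: "Poly_Mapping.lookup (Poly_Mapping.single 0 c * f) m = c * Poly_Mapping.lookup f m"
    for c :: complex and f :: coordinate_poly
  proof -
    have "Poly_Mapping.single 0 c * f = Poly_Mapping.map ((*) c) f"
      by (rule mult_map_scale_conv_mult[symmetric])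
    then show ?thesis by (simp add: map.rep_eq when_def)
  qed
  have "0 = plucker_eval (\<Sum>cs\<in>S. const_poly (a cs) * prod_list (map plucker_var cs))"
    using plucker_eval_ideal[OF rel] by simp
  also have "\<dots> = (\<Sum>cs\<in>S. Poly_Mapping.single 0 (a cs) * ?F cs)"
    unfolding const[symmetric] unfolding plucker_eval_def by (rule poly_subst_sum)
  finally have "Poly_Mapping.lookup (\<Sum>cs\<in>S. Poly_Mapping.single 0 (a cs) * ?F cs) m = 0" by simp
  then show "(\<Sum>cs\<in>S. a cs * Poly_Mapping.lookup (?F cs) m) = 0"
    by (simp add: lookup_sum scale)
qed

text \<open>Two standard monomials with the same class would satisfy a linear relation with
  coefficients 1 and -1.\<close>

lemma column_class_inj:
  assumes "D \<subseteq> {..n}"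
  shows "inj_on (column_class n D) (standard_columns n D)"
proof (rule inj_onI, rule ccontr)
  fix cs cs' assume cs: "cs \<in> standard_columns n D" "cs' \<in> standard_columns n D"
    and eq: "column_class n D cs = column_class n D cs'" and ne: "cs \<noteq> cs'"
  let ?a = "\<lambda>c. if c = cs then 1 else - 1 :: complex"
  have "(\<Sum>c\<in>{cs, cs'}. const_poly (?a c) * prod_list (map plucker_var c)) =
      prod_list (map plucker_var cs) - prod_list (map plucker_var cs')"
    using ne by (simp add: const_poly_def single_uminus)
  also have "\<dots> \<in> degenerate_plucker_ideal n D"
    using eq cs by (intro quotient_class_eqD) (simp_all add: standard_monomial_in column_class_def)
  finally have "\<forall>c\<in>{cs, cs'}. ?a c = 0"
    by (rule standard_monomials_independent[OF assms, rotated 2]) (use cs in auto)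
  then show False by simp
qed

lemma column_class_basis:
  assumes D: "D \<subseteq> {..n}"
  shows "vectorspace.basis class_ring (degenerate_plucker_algebra n D)
    (column_class n D ` standard_columns n D)"
proof -
  let ?A = "degenerate_plucker_algebra n D" and ?q = "quotient_class n D"
  let ?B = "column_class n D ` standard_columns n D"
  interpret vectorspace class_ring ?A by (rule degenerate_plucker_algebra_vectorspace)
  note A = degenerate_plucker_algebra_simps
  have BA: "?B \<subseteq> carrier ?A"
    by (auto simp: A column_class_def standard_monomial_in)
  have I: "degenerate_plucker_ideal n D \<subseteq> carrier (plucker_ring n D)"
    using ideal.axioms(1)[OF degenerate_plucker_ideal_ideal] additive_subgroup.a_subset by blast
  have sub: "submodule class_ring (span ?B) ?A" by (rule span_is_submodule[OF BA])
  have "f \<in> carrier (plucker_ring n D) \<and> ?q f \<in> span ?B" if "f \<in> standard_span n D" for f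
    using that
  proof induction
    case (ideal f)
    have "?q f = \<zero>\<^bsub>?A\<^esub>"
      unfolding A(2) using quotient_class_ideal[OF ideal] quotient_class_ideal[OF zero_in_ideal] by simp
    then show ?case using ideal I LinearCombinations.submodule.zero_closed[OF sub] by auto
  next
    case (standard cs)
    then show ?case using in_own_span[OF BA] by (auto simp: standard_monomial_in column_class_def)
  next
    case (add f g)
    then show ?case using LinearCombinations.submodule.m_closed[OF sub, of "?q f" "?q g"] by (simp add: A add_in)
  next
    case (scale f c)
    then show ?case using LinearCombinations.submodule.smult_closed[OF sub, of c "?q f"] by (simp add: A mult_in const_in)
  qed
  then have gen: "gen_set ?B"
    using carrier_subset_standard_span[of n D] span_is_subset2[OF BA] by (auto simp: A)
  \<comment> \<open>Linear combinations run over sets of vectors. Injectivity of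
    \<open>column_class\<close> lets them be indexed by lists of columns without merging
    terms.\<close>
  have lincomb: "lincomb a (column_class n D ` S) =
      ?q (\<Sum>cs\<in>S. const_poly (a (column_class n D cs)) * prod_list (map plucker_var cs))"
    if "finite S" "S \<subseteq> standard_columns n D" for a S
    using that
  proof (induction S)
    case empty
    show ?case by (simp add: lincomb_def A)
  next
    case (insert cs S)
    have inj: "inj_on (column_class n D) (insert cs S)"
      using column_class_inj[OF D] insert.prems by (rule inj_on_subset)
    then have new: "column_class n D cs \<notin> column_class n D ` S" using insert.hyps by auto
    have cl: "column_class n D ` S \<subseteq> carrier ?A" "column_class n D cs \<in> carrier ?A"
      using BA insert.prems by auto
    have "lincomb a (column_class n D ` insert cs S) =
        (a (column_class n D cs) \<odot>\<^bsub>?A\<^esub> column_class n D cs) \<oplus>\<^bsub>?A\<^esub> lincomb a (column_class n D ` S)"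
      unfolding lincomb_def image_insert
      using insert.hyps(1) new cl by (intro finsum_insert) auto
    also have "\<dots> = ?q (const_poly (a (column_class n D cs)) * prod_list (map plucker_var cs) +
        (\<Sum>cs\<in>S. const_poly (a (column_class n D cs)) * prod_list (map plucker_var cs)))"
      using insert by (simp add: A column_class_def standard_monomial_in mult_in const_in sum_in subset_iff)
    finally show ?case using insert.hyps by simp
  qed
  have "lin_indpt ?B"
  proof
    assume "lin_dep ?B"
    then obtain B a v where B: "finite B" "B \<subseteq> ?B" "lincomb a B = \<zero>\<^bsub>?A\<^esub>" "v \<in> B" "a v \<noteq> 0"
      unfolding lin_dep_def by auto
    then obtain S where S: "S \<subseteq> standard_columns n D" "finite S" "B = column_class n D ` S"
      by (meson finite_subset_image)
    let ?f = "\<Sum>cs\<in>S. const_poly (a (column_class n D cs)) * prod_list (map plucker_var cs)"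
    have "?f \<in> carrier (plucker_ring n D)"
      using S(1) by (intro sum_in mult_in const_in standard_monomial_in) auto
    moreover have "?q ?f = ?q 0" using B(3) lincomb[OF S(2,1)] S(3) by (simp add: A)
    ultimately have "?f \<in> degenerate_plucker_ideal n D"
      using quotient_class_eqD[of ?f n D 0] by (simp add: zero_in)
    then have "\<forall>cs\<in>S. a (column_class n D cs) = 0"
      by (rule standard_monomials_independent[OF D S(2,1)])
    then show False using B S(3) by auto
  qed
  with gen BA show ?thesis by (simp add: basis_def)
qed

lemma tableau_columns_bij:
  assumes "D \<subseteq> {1..n - 1}"
  shows "bij_betw (\<lambda>(lam, T). tableau_columns n lam T)
    (SIGMA lam:dominant_weights D. semistandard_pbw_tableaux n lam) (standard_columns n D)"
proof -
  have fin: "finite D" using assms finite_subset by blast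
  have pbw: "semistandard_pbw_tableaux n lam \<subseteq> pbw_tableaux n lam" for lam
    by (auto simp: semistandard_pbw_tableaux_def)
  show ?thesis
  proof (rule bij_betw_imageI)
    show "inj_on (\<lambda>(lam, T). tableau_columns n lam T)
        (SIGMA lam:dominant_weights D. semistandard_pbw_tableaux n lam)"
      using tableau_columns_inj[OF assms] pbw by (auto simp: inj_on_def) blast+
    show "(\<lambda>(lam, T). tableau_columns n lam T) `
        (SIGMA lam:dominant_weights D. semistandard_pbw_tableaux n lam) = standard_columns n D"
      using tableau_columns_standard[OF fin] tableau_columns_surj[OF assms] by force
  qed
qed

theorem theorem3p28:
  fixes n s :: nat and d :: "nat \<Rightarrow> nat"
  assumes "n \<ge> 2" and "s \<ge> 1"
    and "strict_mono_on {1..s} d" and "1 \<le> d 1" and "d s \<le> n - 1"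
  shows "inj_on (tableau_class n (d ` {1..s}))
           (SIGMA lam:dominant_weights (d ` {1..s}). semistandard_pbw_tableaux n lam) \<and>
         vectorspace.basis class_ring (degenerate_plucker_algebra n (d ` {1..s}))
           (tableau_class n (d ` {1..s}) `
             (SIGMA lam:dominant_weights (d ` {1..s}). semistandard_pbw_tableaux n lam))"
proof -
  let ?D = "d ` {1..s}" and ?c = "\<lambda>(lam, T). tableau_columns n lam T"
  let ?S = "SIGMA lam:dominant_weights ?D. semistandard_pbw_tableaux n lam"
  have "1 \<le> d i \<and> d i \<le> n - 1" if "i \<in> {1..s}" for i
    using strict_mono_on_leD[OF assms(3), of 1 i] strict_mono_on_leD[OF assms(3), of i s] that assms by auto
  then have D: "?D \<subseteq> {1..n - 1}" by auto
  then have D': "?D \<subseteq> {..n}" by fastforce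
  have bij: "bij_betw ?c ?S (standard_columns n ?D)" by (rule tableau_columns_bij[OF D])
  \<comment> \<open>A tableau enters its class only through its list of columns, so injectivity and
    the basis property transfer along the bijection.\<close>
  have eq: "tableau_class n ?D = column_class n ?D \<circ> ?c"
    by (auto simp: tableau_class_def column_class_def tableau_monomial_columns)
  have img: "?c ` ?S = standard_columns n ?D" using bij by (simp add: bij_betw_def)
  have "inj_on (tableau_class n ?D) ?S"
    unfolding eq using bij column_class_inj[OF D'] by (intro comp_inj_on) (simp_all add: bij_betw_def)
  moreover have "tableau_class n ?D ` ?S = column_class n ?D ` standard_columns n ?D"
    unfolding eq image_comp[symmetric] img ..
  ultimately show ?thesis using column_class_basis[OF D'] by simp
qed

end
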